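(* Let $N>5$ be an integer, and let a tiling of the regular $N$-gon $R_N$ with triangles of angles $\alpha,\beta,\gamma$ be given, where $\alpha,\beta,\gamma$ are rational multiples of $\pi$. If the equation at every vertex $V_j$ ($j=1,\ldots,N$) of $R_N$ is $\alpha=\delta_N$, then $\beta=\gamma=\pi/N$.
   Context: A tiling of a polygon $A$ is a decomposition of $A$ into finitely many nonoverlapping polygons (pairwise disjoint interiors, union $A$); no other condition is imposed, so two pieces may share a boundary point without sharing a common side. Here all tiles are triangles with angles $\alpha,\beta,\gamma$ (hence similar to each other, possibly of different sizes and possibly reflected). In each tile the three angles are labelled $\alpha,\beta,\gamma$. $\delta_N=(N-2)\pi/N$ is the angle of $R_N$, and $V_1,\ldots,V_N$ are its vertices. If the numbers of angles $\alpha,\beta,\gamma$ of the tiles meeting at $V_j$ are $p_j,q_j,r_j$, respectively, then $p_j\alpha+q_j\beta+r_j\gamma=\delta_N$ is called the equation at the vertex $V_j$; thus the equation at $V_j$ is $\alpha=\delta_N$ means $(p_j,q_j,r_j)=(1,0,0)$. *)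

theory Defs
  imports "HOL-Analysis.Analysis"
begin

text \<open>The Euclidean plane is \<^typ>\<open>complex\<close>, with its real inner product and Euclidean norm.\<close>

definition angle_at :: "complex \<Rightarrow> complex \<Rightarrow> complex \<Rightarrow> real" where
  "angle_at A B C = arccos (((B - A) \<bullet> (C - A)) / (norm (B - A) * norm (C - A)))"

text \<open>A tile is the list of its vertices in the order of the labels of its angles:
  the first vertex carries the angle labelled \<open>\<alpha>\<close>, the second \<open>\<beta>\<close>, the third \<open>\<gamma>\<close>.
  No orientation is imposed, so reflected copies are allowed.\<close>

type_synonym tile = "complex \<times> complex \<times> complex"

fun region :: "tile \<Rightarrow> complex set" where
  "region (A, B, C) = convex hull {A, B, C}"

fun triangle_with_angles :: "real \<Rightarrow> real \<Rightarrow> real \<Rightarrow> tile \<Rightarrow> bool" where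
  "triangle_with_angles \<alpha> \<beta> \<gamma> (A, B, C) \<longleftrightarrow>
     \<not> collinear {A, B, C} \<and>
     angle_at A B C = \<alpha> \<and> angle_at B C A = \<beta> \<and> angle_at C A B = \<gamma>"

text \<open>Pieces have nonempty interior, so the second condition also excludes that the same
  triangle occurs in a tiling under two different labellings.\<close>

definition triangle_tiling ::
    "real \<Rightarrow> real \<Rightarrow> real \<Rightarrow> tile set \<Rightarrow> complex set \<Rightarrow> bool" where
  "triangle_tiling \<alpha> \<beta> \<gamma> T P \<longleftrightarrow>
     finite T \<and>
     (\<forall>t\<in>T. triangle_with_angles \<alpha> \<beta> \<gamma> t) \<and>
     pairwise (\<lambda>s t. interior (region s) \<inter> interior (region t) = {}) T \<and>
     (\<Union>t\<in>T. region t) = P"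

text \<open>For \<open>w \<noteq> 0\<close> these range over all regular \<open>N\<close>-gons of the plane:
  \<open>c\<close> is the centre and \<open>c + w\<close> is the vertex with index \<open>N\<close>.\<close>

definition ngon_vertex :: "complex \<Rightarrow> complex \<Rightarrow> nat \<Rightarrow> nat \<Rightarrow> complex" where
  "ngon_vertex c w N j = c + w * cis (2 * pi * real j / real N)"

definition regular_ngon :: "complex \<Rightarrow> complex \<Rightarrow> nat \<Rightarrow> complex set" where
  "regular_ngon c w N = convex hull (ngon_vertex c w N ` {1..N})"

text \<open>The triple \<open>(p, q, r)\<close> of the numbers of angles \<open>\<alpha>\<close>, \<open>\<beta>\<close>, \<open>\<gamma>\<close> of the tiles meeting at
  the point \<open>v\<close>, i.e. the coefficients of the equation at \<open>v\<close>. A vertex of the tiled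
  polygon is an extreme point of it, so every tile containing it has it as a vertex.\<close>

definition angle_counts :: "tile set \<Rightarrow> complex \<Rightarrow> nat \<times> nat \<times> nat" where
  "angle_counts T v =
     (card {(A, B, C) \<in> T. A = v}, card {(A, B, C) \<in> T. B = v}, card {(A, B, C) \<in> T. C = v})"

end

theory Submission
  imports Defs "HOL-Number_Theory.Cong"
begin

text \<open>
  At a vertex of the polygon there is a single tile with the angle \<open>\<alpha>\<close>, so \<open>\<alpha> = \<pi> - 2 \<pi> / N\<close> and
  \<open>\<beta> + \<gamma> = 2 \<pi> / N\<close> (\<open>alpha_eq_ngon_angle\<close>). What remains to be proved is \<open>\<beta> = \<gamma>\<close>.

  Let \<open>\<zeta>\<close> be a primitive \<open>L\<close>-th root of unity such that \<open>cis (2 \<beta>)\<close>, \<open>cis (2 \<gamma>)\<close> and \<open>cis (2 \<pi> / N)\<close> are powers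
  of \<open>\<zeta>\<close>, and let \<open>k\<close> be coprime to \<open>L\<close>. There is an additive map \<open>\<Phi>\<close> of the plane with
  \<open>\<Phi> (\<zeta> z) = \<zeta>\<^sup>k \<Phi> z\<close> that commutes with complex conjugation and does not vanish at \<open>1\<close> (\<open>ex_semilinear\<close>). Its
  existence rests on the irreducibility of the cyclotomic polynomials (\<open>galois_relation\<close>). In
  general \<open>\<Phi>\<close> is not continuous; nevertheless it maps tiles to triangles whose angles are \<open>k \<alpha>\<close>, \<open>k \<beta>\<close>, \<open>k \<gamma>\<close> up to sign and
  multiples of \<open>\<pi>\<close>, and the polygon to a star polygon. Along the lines that matter the image of a line lies
  on a line, so the signed area is still additive: the images of the tiles have total signed area that of the
  star polygon, once tiles with sides in directions unrelated to those of the polygon are left out. This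
  additivity needs only that the contributions of directed segments be additive along lines
  (\<open>triangle_valuation_eq_0\<close>, \<open>tiling_valuation\<close>).

  The images of the tiles, unless degenerate, have areas of one and the same sign, the sign of
  \<open>sin (2 k \<pi> / N) sin (k \<beta>) sin (k \<gamma>)\<close>, while the area of the star polygon has the sign of \<open>sin (2 k \<pi> / N)\<close>.
  Therefore \<open>sin (k \<beta>) sin (k \<gamma>) > 0\<close> (\<open>conjugate_sines_positive\<close>), which says
  \<open>cos (k (\<beta> - \<gamma>)) > cos (2 k \<pi> / N)\<close>, for every \<open>k\<close> coprime to \<open>L\<close>. Averaging this inequality over suitable
  \<open>k\<close> forces \<open>\<beta> - \<gamma> = 0\<close> as soon as \<open>N > 5\<close> (\<open>totally_positive_imp_zero\<close>).
\<close>

section \<open>Integer relations between roots of unity\<close>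

text \<open>The value of an integer polynomial at a complex number.\<close>

abbreviation int_poly_at :: "int poly \<Rightarrow> complex \<Rightarrow> complex" where
  "int_poly_at q z \<equiv> poly (map_poly of_int q) z"

lemma map_poly_of_int_add:
  "map_poly of_int (p + q) = map_poly of_int p + (map_poly of_int q :: 'a :: ring_1 poly)"
  by (rule poly_eqI) (simp add: coeff_map_poly)

lemma int_poly_at_simps [simp]:
  "int_poly_at (p + q) z = int_poly_at p z + int_poly_at q z"
  "int_poly_at (p * q) z = int_poly_at p z * int_poly_at q z"
  "int_poly_at (smult c q) z = of_int c * int_poly_at q z"
  proof -
  show "int_poly_at (p + q) z = int_poly_at p z + int_poly_at q z"
    by (simp add: map_poly_of_int_add)
  show "int_poly_at (smult c q) z = of_int c * int_poly_at q z"
    by (subst map_poly_smult) auto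
  show "int_poly_at (p * q) z = int_poly_at p z * int_poly_at q z"
  proof (induction p)
    case (pCons a p)
    have "int_poly_at (pCons a p * q) z = int_poly_at (smult a q + pCons 0 (p * q)) z" by simp
    also have "\<dots> = int_poly_at (smult a q) z + int_poly_at (pCons 0 (p * q)) z"
      by (simp add: map_poly_of_int_add)
    also have "int_poly_at (smult a q) z = of_int a * int_poly_at q z"
      by (subst map_poly_smult) auto
    finally show ?case using pCons by (simp add: map_poly_pCons algebra_simps)
  qed auto
qed

lemma freshman_dream:
  fixes x y :: "'a :: comm_ring_1"
  assumes "prime p"
  shows "\<exists>r. (x + y) ^ p = x ^ p + y ^ p + of_nat p * r"
proof -
  have p: "p > 0" using assms prime_gt_0_nat by blast
  have "(x + y) ^ p = (\<Sum>k\<le>p. of_nat (p choose k) * x ^ k * y ^ (p - k))"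
    by (rule binomial_ring)
  also have "{..p} = insert 0 (insert p {1..<p})" using p by auto
  also have "(\<Sum>k\<in>insert 0 (insert p {1..<p}). of_nat (p choose k) * x ^ k * y ^ (p - k))
      = y ^ p + x ^ p + (\<Sum>k\<in>{1..<p}. of_nat (p choose k) * x ^ k * y ^ (p - k))"
    using p by (simp add: algebra_simps)
  also have "(\<Sum>k\<in>{1..<p}. of_nat (p choose k) * x ^ k * y ^ (p - k))
      = (\<Sum>k\<in>{1..<p}. of_nat p * (of_nat ((p choose k) div p) * x ^ k * y ^ (p - k)))"
  proof (rule sum.cong [OF refl])
    fix k assume k: "k \<in> {1..<p}"
    have "p dvd (p choose k)" using dvd_choose_prime[of k p] k assms by auto
    then have "p choose k = p * ((p choose k) div p)" by simp
    then show "of_nat (p choose k) * x ^ k * y ^ (p - k) = of_nat p * (of_nat ((p choose k) div p) * x ^ k * y ^ (p - k))"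
      by (metis of_nat_mult mult.assoc)
  qed
  finally show ?thesis
    by (intro exI[of _ "\<Sum>k\<in>{1..<p}. of_nat ((p choose k) div p) * x ^ k * y ^ (p - k)"])
      (simp add: sum_distrib_left algebra_simps)
qed

lemma fermat_int:
  fixes a :: int
  assumes "prime p"
  shows "\<exists>r. a ^ p = a + int p * r"
proof -
  have p: "p > 0" using assms prime_gt_0_nat by blast
  have nat: "\<exists>r. int n ^ p = int n + int p * r" for n
  proof (induction n)
    case 0 then show ?case using p by (intro exI[of _ 0]) auto
  next
    case (Suc n)
    then obtain r where r: "int n ^ p = int n + int p * r" by blast
    from freshman_dream[OF assms, of "int n" 1] obtain s where "(int n + 1) ^ p = int n ^ p + 1 + int p * s" by auto
    then have "int (Suc n) ^ p = int (Suc n) + int p * (r + s)" using r by (simp add: algebra_simps)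
    then show ?case by blast
  qed
  from nat obtain r where r: "int (nat (a mod p)) ^ p = int (nat (a mod p)) + int p * r" by blast
  have "[a ^ p = (a mod p) ^ p] (mod p)" by (simp add: cong_def power_mod)
  moreover have "(a mod p) ^ p = a mod p + int p * r" using r p by simp
  ultimately have "[a ^ p = a] (mod p)" by (simp add: cong_def)
  then show ?thesis by (metis cong_iff_lin cong_sym)
qed

lemma frobenius_int_poly:
  fixes f :: "int poly"
  assumes "prime p"
  shows "\<exists>g. f ^ p = pcompose f (monom 1 p) + smult (int p) g"
proof (induction f)
  case 0
  have "p > 0" using assms prime_gt_0_nat by blast
  then show ?case by (intro exI[of _ 0]) auto
next
  case (pCons a f)
  then obtain g where g: "f ^ p = pcompose f (monom 1 p) + smult (int p) g" by blast
  obtain r where r: "a ^ p = a + int p * r" using fermat_int[OF assms] by blast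
  obtain s where s: "([:a:] + monom 1 1 * f) ^ p = [:a:] ^ p + (monom 1 1 * f) ^ p + of_nat p * s"
    using freshman_dream[OF assms] by blast
  have e: "pCons a f = [:a:] + monom 1 1 * f" by (simp add: monom_altdef)
  have c: "[:a:] ^ p = [:a ^ p:]" by (induction p) auto
  have "(pCons a f) ^ p = [:a ^ p:] + monom 1 p * f ^ p + of_nat p * s"
    unfolding e s by (simp add: c power_mult_distrib monom_power)
  also have "\<dots> = pcompose (pCons a f) (monom 1 p) + smult (int p) ([:r:] + monom 1 p * g + s)"
    by (simp add: g r pcompose_pCons algebra_simps smult_add_right of_nat_poly)
  finally show ?case by blast
qed

text \<open>The Frobenius congruence \<open>f(z\<^sup>p) \<equiv> f(z)\<^sup>p\<close> modulo \<open>p \<int>[z]\<close>.\<close>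

lemma int_poly_at_frobenius:
  assumes "prime p"
  shows "\<exists>g. int_poly_at f (z ^ p) = int_poly_at f z ^ p + of_nat p * int_poly_at g z"
proof -
  obtain g where g: "f ^ p = pcompose f (monom 1 p) + smult (int p) g"
    using frobenius_int_poly[OF assms] by blast
  have "int_poly_at f z ^ p = int_poly_at (f ^ p) z"
    by (induction p) auto
  also have "\<dots> = int_poly_at (pcompose f (monom 1 p)) z + of_nat p * int_poly_at g z"
    by (simp add: g)
  also have "int_poly_at (pcompose f (monom 1 p)) z = int_poly_at f (z ^ p)"
    by (induction f) (auto simp: pcompose_pCons map_poly_pCons poly_monom map_poly_monom)
  finally show ?thesis by (intro exI[of _ "smult (-1) g"]) (simp only: int_poly_at_simps, simp)
qed

text \<open>The complex numbers as a vector space over the rationals.\<close>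

interpretation rat_complex: vector_space_pair
  "\<lambda>(q::rat) (z::complex). of_rat q * z" "\<lambda>(q::rat) (z::complex). of_rat q * z"
  by unfold_locales (simp_all add: algebra_simps of_rat_add of_rat_mult)

lemma ex_rational_functional:
  fixes u :: complex
  assumes "u \<noteq> 0"
  shows "\<exists>l::complex \<Rightarrow> rat. (\<forall>x y. l (x + y) = l x + l y) \<and> (\<forall>q x. l (of_rat q * x) = q * l x) \<and> l u \<noteq> 0"
proof -
  let ?B = "rat_complex.vs1.extend_basis {u}"
  have i: "rat_complex.vs1.independent {u}" using assms by simp
  have B: "rat_complex.vs1.independent ?B" "rat_complex.vs1.span ?B = UNIV" "u \<in> ?B"
    using rat_complex.vs1.independent_extend_basis[OF i] rat_complex.vs1.span_extend_basis[OF i]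
      rat_complex.vs1.extend_basis_superset[OF i] by auto
  let ?l = "\<lambda>v. rat_complex.vs1.representation ?B v u"
  have "?l (x + y) = ?l x + ?l y" for x y
    using rat_complex.vs1.representation_add[OF B(1), of y x] B(2) by simp
  moreover have "?l (of_rat q * x) = q * ?l x" for q x
    using rat_complex.vs1.representation_scale[OF B(1), of x q] B(2) by simp
  moreover have "?l u \<noteq> 0"
    using rat_complex.vs1.representation_basis[OF B(1) B(3)] by simp
  ultimately show ?thesis by (intro exI[of _ ?l]) blast
qed

lemma common_denominator:
  fixes r :: "nat \<Rightarrow> rat"
  shows "\<exists>D::int. D > 0 \<and> (\<forall>i<n. of_int D * r i \<in> \<int>)"
proof (induction n)
  case 0 then show ?case by (intro exI[of _ 1]) auto
next
  case (Suc n)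
  then obtain D where D: "D > 0" "\<forall>i<n. of_int D * r i \<in> \<int>" by blast
  obtain a b where ab: "r n = Fract a b" "b > 0" by (cases "r n") auto
  have "of_int (D * b) * r i \<in> \<int>" if "i < Suc n" for i
  proof (cases "i = n")
    case True
    have "of_int (D * b) * r n = of_int (D * a)" using ab by (simp add: Fract_of_int_quotient)
    then show ?thesis using True by (metis Ints_of_int)
  next
    case False
    have "of_int b * (of_int D * r i) \<in> \<int>"
      by (rule Ints_mult) (use D that False in auto)
    then show ?thesis by (simp add: algebra_simps)
  qed
  then show ?case using D ab by (intro exI[of _ "D * b"]) auto
qed

text \<open>A nonzero complex number lies in \<open>p \<int>[\<zeta>]\<close> for only finitely many \<open>p\<close>: a rational functional
  that does not vanish at \<open>u\<close> takes values with a common denominator on \<open>\<int>[\<zeta>]\<close>, because only finitely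
  many powers of \<open>\<zeta>\<close> are distinct.\<close>

lemma finitely_many_prime_divisors:
  fixes \<zeta> u :: complex
  assumes "L > 0" "\<zeta> ^ L = 1" "u \<noteq> 0"
  shows "\<exists>A::nat. \<forall>p>A. \<forall>g j. u \<noteq> of_nat p * int_poly_at g (\<zeta> ^ j)"
proof -
  obtain l :: "complex \<Rightarrow> rat" where l: "\<And>x y. l (x + y) = l x + l y"
      "\<And>q x. l (of_rat q * x) = q * l x" "l u \<noteq> 0"
    using ex_rational_functional[OF assms(3)] by blast
  have lint: "l (of_int m * x) = of_int m * l x" for m x using l(2)[of "of_int m" x] by simp
  have l0: "l 0 = 0" using l(1)[of 0 0] by simp
  have lsum: "l (sum f S) = (\<Sum>x\<in>S. l (f x))" for f and S :: "nat set"
    by (induction S rule: infinite_finite_induct) (auto simp: l l0)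
  obtain D where D: "D > 0" "\<And>i. i < L \<Longrightarrow> of_int D * l (\<zeta> ^ i) \<in> \<int>"
    using common_denominator[of L "\<lambda>i. l (\<zeta> ^ i)"] by blast
  have D': "of_int D * l (\<zeta> ^ i) \<in> \<int>" for i
  proof -
    have "\<zeta> ^ i = \<zeta> ^ (L * (i div L) + i mod L)" by simp
    also have "\<dots> = \<zeta> ^ (i mod L)" unfolding power_add power_mult by (simp add: assms)
    finally show ?thesis using D(2)[of "i mod L"] assms by simp
  qed
  have int: "of_int D * l (int_poly_at g (\<zeta> ^ j)) \<in> \<int>" for g j
  proof -
    have "of_int D * l (int_poly_at g (\<zeta> ^ j)) = (\<Sum>i\<le>degree (map_poly of_int g :: complex poly). of_int (coeff g i) * (of_int D * l (\<zeta> ^ (j * i))))"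
      unfolding poly_altdef lsum
      by (simp add: lsum coeff_map_poly lint sum_distrib_left power_mult mult.left_commute)
    also have "\<dots> \<in> \<int>" by (intro Ints_sum Ints_mult D') auto
    finally show ?thesis .
  qed
  show ?thesis
  proof (intro exI[of _ "nat \<lceil>\<bar>of_int D * l u\<bar>\<rceil>"] allI impI notI)
    fix p g j
    assume p: "p > nat \<lceil>\<bar>of_int D * l u\<bar>\<rceil>" and u: "u = of_nat p * int_poly_at g (\<zeta> ^ j)"
    obtain m where m: "of_int D * l (int_poly_at g (\<zeta> ^ j)) = of_int m" using int[of g j] by (metis Ints_cases)
    have "l u = of_nat p * l (int_poly_at g (\<zeta> ^ j))" using lint[of "int p"] by (simp add: u)
    then have e: "of_int D * l u = of_int (int p * m)" using m by (simp add: mult.left_commute)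
    then have "m \<noteq> 0" using l(3) D(1) by auto
    then have "int p \<le> \<bar>int p * m\<bar>" using mult_left_mono[of 1 "\<bar>m\<bar>" "int p"] by (simp add: abs_mult)
    moreover have "int p > \<bar>int p * m\<bar>" using p unfolding e of_int_abs[symmetric] ceiling_of_int by linarith
    ultimately show False by simp
  qed
qed

text \<open>Irreducibility of the cyclotomic polynomials, in the form that an integer relation between powers of
  \<open>\<zeta>\<close> survives the substitution of \<open>\<zeta>\<^sup>k\<close> for \<open>\<zeta>\<close>. If the relation holds at \<open>\<zeta>\<^sup>j\<close> then its value at
  \<open>\<zeta>\<^bsup>jp\<^esup>\<close> is in \<open>p \<int>[\<zeta>]\<close> by the Frobenius congruence, and hence is zero once \<open>p\<close> is large. It remains to
  replace \<open>k\<close> by a congruent number that has large prime factors only; the primes need not avoid \<open>L\<close>.\<close>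

lemma galois_relation:
  fixes \<zeta> :: complex
  assumes L: "L > 0" "\<zeta> ^ L = 1" and k: "coprime k L" and q: "int_poly_at q \<zeta> = 0"
  shows "int_poly_at q (\<zeta> ^ k) = 0"
proof -
  let ?z = "\<lambda>k. int_poly_at q (\<zeta> ^ k)"
  have per: "\<zeta> ^ i = \<zeta> ^ (i mod L)" for i
  proof -
    have "\<zeta> ^ i = \<zeta> ^ (L * (i div L) + i mod L)" by simp
    also have "\<dots> = \<zeta> ^ (i mod L)" unfolding power_add power_mult by (simp add: assms)
    finally show ?thesis .
  qed
  have "\<exists>A::nat. \<forall>j<n. \<forall>p>A. ?z j \<noteq> 0 \<longrightarrow> (\<forall>g i. ?z j \<noteq> of_nat p * int_poly_at g (\<zeta> ^ i))" for n
  proof (induction n)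
    case (Suc n)
    then obtain A where A: "\<forall>j<n. \<forall>p>A. ?z j \<noteq> 0 \<longrightarrow> (\<forall>g i. ?z j \<noteq> of_nat p * int_poly_at g (\<zeta> ^ i))" by blast
    obtain A' where A': "?z n \<noteq> 0 \<longrightarrow> (\<forall>p>A'. \<forall>g i. ?z n \<noteq> of_nat p * int_poly_at g (\<zeta> ^ i))"
      using finitely_many_prime_divisors[OF L, of "?z n"] by blast
    show ?case using A A' by (intro exI[of _ "max A A'"]) (auto simp: less_Suc_eq)
  qed auto
  then obtain A :: nat where A: "\<And>j p g i. j < L \<Longrightarrow> p > A \<Longrightarrow> ?z j \<noteq> 0 \<Longrightarrow> ?z j \<noteq> of_nat p * int_poly_at g (\<zeta> ^ i)"
    by meson
  have step: "?z (j * p) = 0" if z: "?z j = 0" and p: "prime p" "p > A" for j p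
  proof -
    obtain g where g: "?z (j * p) = ?z j ^ p + of_nat p * int_poly_at g (\<zeta> ^ j)"
      using int_poly_at_frobenius[OF p(1), of q "\<zeta> ^ j"] by (auto simp: power_mult)
    have "p > 0" using p(2) by simp
    then have "?z ((j * p) mod L) = of_nat p * int_poly_at g (\<zeta> ^ j)" using g z per[of "j * p"] by simp
    then show ?thesis using A[of "(j * p) mod L" p g j] L p(2) per[of "j * p"] by auto
  qed
  have main: "(\<forall>p. prime p \<longrightarrow> p dvd m \<longrightarrow> p > A) \<Longrightarrow> m > 0 \<Longrightarrow> ?z m = 0" for m
  proof (induction m rule: less_induct)
    case (less m)
    show ?case
    proof (cases "m = 1")
      case False
      then obtain p where p: "prime p" "p dvd m" using prime_factor_nat by blast
      then obtain m' where m': "m = m' * p" by (metis dvdE mult.commute)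
      have "?z m' = 0"
        by (rule less.IH) (use less.prems p m' in \<open>auto simp: prime_gt_Suc_0_nat\<close>)
      then show ?thesis using step p less.prems m' by blast
    qed (use q in simp)
  qed
  \<comment> \<open>This number is congruent to \<open>k\<close>, and no prime up to \<open>A\<close> divides it.\<close>
  define P where "P = {p. prime p \<and> p \<le> A \<and> \<not> p dvd k}"
  define m where "m = k + L * \<Prod>P"
  have fin: "finite P" unfolding P_def by (rule finite_subset[of _ "{..A}"]) auto
  have "p > A" if p: "prime p" "p dvd m" for p
  proof (rule ccontr)
    assume "\<not> p > A"
    show False
    proof (cases "p dvd k")
      case True
      then have "\<not> p dvd L" using k p(1) by (meson coprime_common_divisor_nat not_prime_unit coprime_def)
      moreover have "p dvd L * \<Prod>P" using p(2) True unfolding m_def by (simp add: dvd_add_right_iff)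
      ultimately have "p dvd \<Prod>P" using p(1) prime_dvd_multD by blast
      then obtain r where r: "r \<in> P" "p dvd r"
        using prime_dvd_prod_iff[OF fin p(1), of "\<lambda>x. x"] by auto
      then have "r = p" using p(1) primes_dvd_imp_eq by (auto simp: P_def)
      then show False using r True by (auto simp: P_def)
    next
      case False
      then have "p \<in> P" using p \<open>\<not> p > A\<close> by (auto simp: P_def)
      then have "p dvd L * \<Prod>P" using dvd_prodI[OF fin, of p "\<lambda>x. x"] by (simp add: dvd_mult)
      then have "p dvd k" using p(2) unfolding m_def by (simp add: dvd_add_left_iff)
      then show False using False by simp
    qed
  qed
  moreover have "m > 0"
  proof -
    have "\<Prod>P > 0" by (intro prod_pos) (auto simp: P_def prime_gt_0_nat)
    then show ?thesis using L by (simp add: m_def)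
  qed
  ultimately have "?z m = 0" using main by blast
  moreover have "\<zeta> ^ m = \<zeta> ^ k" by (simp add: m_def power_add power_mult L)
  ultimately show ?thesis by simp
qed

section \<open>Semilinear maps of the plane\<close>

lemma int_poly_at_sum: "int_poly_at (sum f S) z = (\<Sum>x\<in>S. int_poly_at (f x) z)"
  by (induction S rule: infinite_finite_induct) (simp_all add: map_poly_of_int_add)

text \<open>The conjugation \<open>\<zeta>\<^sup>i \<mapsto> \<zeta>\<^bsup>ki\<^esup>\<close> extends additively to all complex numbers. It is multiplicative on
  \<open>\<rat>(\<zeta>)\<close>, but nothing of the kind is claimed elsewhere.\<close>

lemma ex_rational_linear_galois:
  fixes \<zeta> :: complex
  assumes L: "L > 0" "\<zeta> ^ L = 1" and k: "coprime k L"
  shows "\<exists>h :: complex \<Rightarrow> complex. (\<forall>x y. h (x + y) = h x + h y) \<and> (\<forall>i. h (\<zeta> ^ i) = \<zeta> ^ (k * i))"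
proof -
  define S where "S = (\<lambda>i. \<zeta> ^ i) ` {..<L}"
  obtain B where B: "B \<subseteq> S" "rat_complex.vs1.independent B" "S \<subseteq> rat_complex.vs1.span B"
    using rat_complex.vs1.maximal_independent_subset[of S] by blast
  have fin: "finite B" using B(1) finite_subset unfolding S_def by blast
  have "\<exists>j. \<forall>b\<in>B. j b < L \<and> \<zeta> ^ (j b) = b"
    using B(1) by (intro bchoice) (auto simp: S_def)
  then obtain j where j: "\<And>b. b \<in> B \<Longrightarrow> j b < L" "\<And>b. b \<in> B \<Longrightarrow> \<zeta> ^ (j b) = b" by blast
  define h where "h = rat_complex.construct B (\<lambda>b. \<zeta> ^ (k * j b))"
  have lin: "Vector_Spaces.linear (\<lambda>(q::rat) (z::complex). of_rat q * z) (\<lambda>(q::rat) (z::complex). of_rat q * z) h"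
    unfolding h_def by (rule rat_complex.linear_construct[OF B(2)])
  have hadd: "h (x + y) = h x + h y" for x y
    using lin by (simp add: rat_complex.linear_add)
  have hscale: "h (of_rat q * x) = of_rat q * h x" for q x
    using lin by (simp add: rat_complex.linear_scale)
  have hsum: "h (sum f C) = (\<Sum>x\<in>C. h (f x))" for f and C :: "complex set"
    using lin by (simp add: rat_complex.linear_sum)
  have hB: "h b = \<zeta> ^ (k * j b)" if "b \<in> B" for b
    unfolding h_def using rat_complex.construct_basis[OF B(2) that] by simp
  have main: "h (\<zeta> ^ i) = \<zeta> ^ (k * i)" if "i < L" for i
  proof -
    have "\<zeta> ^ i \<in> rat_complex.vs1.span B" using B(3) that by (auto simp: S_def)
    define r where "r b = rat_complex.vs1.representation B (\<zeta> ^ i) b" for b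
    have z: "\<zeta> ^ i = (\<Sum>b\<in>B. of_rat (r b) * b)"
      unfolding r_def
      by (rule rat_complex.vs1.sum_representation_eq[symmetric, OF B(2)]) (use fin \<open>\<zeta> ^ i \<in> _\<close> in auto)
    obtain D where D: "D > 0" "\<And>i. i < L \<Longrightarrow> of_int D * r (\<zeta> ^ i) \<in> \<int>"
      using common_denominator[of L "\<lambda>i. r (\<zeta> ^ i)"] by blast
    have "\<exists>c. \<forall>b\<in>B. of_int D * r b = of_int (c b)"
    proof (intro bchoice ballI)
      fix b assume "b \<in> B"
      then have "of_int D * r b \<in> \<int>" using D(2)[of "j b"] j[of b] by simp
      then show "\<exists>y. of_int D * r b = of_int y" by (metis Ints_cases)
    qed
    then obtain c where c: "\<And>b. b \<in> B \<Longrightarrow> of_int D * r b = of_int (c b)" by blast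
    have c': "of_int D * of_rat (r b) = (of_int (c b) :: complex)" if "b \<in> B" for b
      using c[OF that] by (metis of_rat_mult of_rat_of_int_eq)
    define q where "q = monom D i + smult (-1) (\<Sum>b\<in>B. monom (c b) (j b))"
    have q: "int_poly_at q x = of_int D * x ^ i - (\<Sum>b\<in>B. of_int (c b) * x ^ j b)" for x
      unfolding q_def int_poly_at_simps int_poly_at_sum by (simp add: map_poly_monom poly_monom)
    have "of_int D * \<zeta> ^ i = (\<Sum>b\<in>B. (of_int D * of_rat (r b)) * b)"
      by (subst z) (simp add: sum_distrib_left mult.assoc)
    also have "\<dots> = (\<Sum>b\<in>B. of_int (c b) * \<zeta> ^ j b)"
      by (intro sum.cong refl) (simp add: c' j)
    finally have "int_poly_at q \<zeta> = 0" by (simp add: q)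
    then have "int_poly_at q (\<zeta> ^ k) = 0" by (rule galois_relation[OF L k])
    then have e: "of_int D * \<zeta> ^ (k * i) = (\<Sum>b\<in>B. of_int (c b) * \<zeta> ^ (k * j b))"
      by (simp add: q power_mult)
    also have "\<dots> = (\<Sum>b\<in>B. (of_int D * of_rat (r b)) * h b)"
      by (intro sum.cong refl) (simp add: c' hB)
    also have "\<dots> = of_int D * h (\<zeta> ^ i)"
      by (subst z) (simp add: hsum hscale sum_distrib_left mult.assoc)
    finally show ?thesis using D(1) by simp
  qed
  have "h (\<zeta> ^ i) = \<zeta> ^ (k * i)" for i
  proof -
    have "\<zeta> ^ (L * (i div L) + i mod L) = \<zeta> ^ (i mod L)"
      unfolding power_add power_mult by (simp add: L)
    moreover have "\<zeta> ^ (k * (L * (i div L) + i mod L)) = (\<zeta> ^ L) ^ (k * (i div L)) * \<zeta> ^ (k * (i mod L))"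
    proof -
      have "k * (L * (i div L) + i mod L) = L * (k * (i div L)) + k * (i mod L)"
        by (metis add_mult_distrib2 mult.left_commute)
      then show ?thesis by (simp only: power_add power_mult)
    qed
    ultimately show ?thesis using main[of "i mod L"] L by simp
  qed
  then show ?thesis using hadd by blast
qed

text \<open>An additive map of the plane that is semilinear with respect to the conjugation of the cyclotomic field
  and commutes with complex conjugation. Twisted averaging over the group of \<open>L\<close>-th roots of unity turns any
  additive map into a semilinear one, and the extension from the previous lemma is not annihilated by it.\<close>

lemma ex_semilinear:
  fixes \<zeta> :: complex
  assumes L: "L > 0" "\<zeta> ^ L = 1" and k: "coprime k L"
  shows "\<exists>\<Phi> :: complex \<Rightarrow> complex. (\<forall>x y. \<Phi> (x + y) = \<Phi> x + \<Phi> y) \<and> (\<forall>z. \<Phi> (\<zeta> * z) = \<zeta> ^ k * \<Phi> z)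
    \<and> (\<forall>z. \<Phi> (cnj z) = cnj (\<Phi> z)) \<and> \<Phi> 1 \<noteq> 0"
proof -
  obtain h :: "complex \<Rightarrow> complex" where h: "\<And>x y. h (x + y) = h x + h y" "\<And>i. h (\<zeta> ^ i) = \<zeta> ^ (k * i)"
    using ex_rational_linear_galois[OF assms] by blast
  have nz: "\<zeta> \<noteq> 0" using L by (metis power_0_left zero_neq_one not_gr_zero)
  have "norm \<zeta> ^ L = 1" using L by (metis norm_one norm_power)
  then have n1: "norm \<zeta> = 1" using L by (metis norm_ge_zero power_eq_1_iff abs_norm_cancel less_not_refl)
  then have "\<zeta> * cnj \<zeta> = 1" using complex_norm_square[of \<zeta>] by simp
  then have cz: "cnj \<zeta> = inverse \<zeta>" by (metis inverse_unique)
  define \<Psi> where "\<Psi> z = (\<Sum>j<L. inverse (\<zeta> ^ (k * j)) * h (\<zeta> ^ j * z))" for z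
  have add: "\<Psi> (x + y) = \<Psi> x + \<Psi> y" for x y
    by (simp add: \<Psi>_def algebra_simps h sum.distrib)
  have semi: "\<Psi> (\<zeta> * z) = \<zeta> ^ k * \<Psi> z" for z
  proof -
    define g where "g j = inverse (\<zeta> ^ (k * j)) * h (\<zeta> ^ j * z)" for j
    have "\<Psi> (\<zeta> * z) = (\<Sum>j<L. \<zeta> ^ k * g (Suc j))"
      unfolding \<Psi>_def g_def using nz by (intro sum.cong refl) (simp add: field_simps power_add)
    also have "\<dots> = \<zeta> ^ k * (\<Sum>j<L. g (Suc j))" by (simp add: sum_distrib_left)
    also have "(\<Sum>j<L. g (Suc j)) = (\<Sum>j<L. g j)"
    proof -
      have "\<zeta> ^ (k * L) = 1" using L by (metis mult.commute power_mult power_one)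
      then have "g L = g 0" by (simp add: g_def L)
      moreover have "(\<Sum>j<L. g (Suc j)) + g 0 = (\<Sum>j<L. g j) + g L"
        using sum.lessThan_Suc_shift[of g L] sum.lessThan_Suc[of g L] by (simp add: add.commute)
      ultimately show ?thesis by simp
    qed
    finally show ?thesis by (simp add: \<Psi>_def g_def)
  qed
  have semi': "\<Psi> (inverse \<zeta> * z) = inverse (\<zeta> ^ k) * \<Psi> z" for z
    using semi[of "inverse \<zeta> * z"] nz by (simp add: field_simps)
  have one: "\<Psi> 1 = of_nat L" using nz by (simp add: \<Psi>_def h)
  \<comment> \<open>This symmetrisation makes the map commute with complex conjugation.\<close>
  define \<Phi> where "\<Phi> z = \<Psi> z + cnj (\<Psi> (cnj z))" for z
  have "\<Phi> (x + y) = \<Phi> x + \<Phi> y" for x y by (simp add: \<Phi>_def add)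
  moreover have "\<Phi> (\<zeta> * z) = \<zeta> ^ k * \<Phi> z" for z
  proof -
    have "cnj (inverse (\<zeta> ^ k)) = \<zeta> ^ k" by (simp add: cz power_inverse)
    then show ?thesis by (simp add: \<Phi>_def semi cz semi' distrib_left)
  qed
  moreover have "\<Phi> (cnj z) = cnj (\<Phi> z)" for z by (simp add: \<Phi>_def)
  moreover have "\<Phi> 1 \<noteq> 0" using L by (simp add: \<Phi>_def one flip: of_nat_add)
  ultimately show ?thesis by blast
qed

section \<open>Boundary sums over families of triangles\<close>

text \<open>The cross product of two plane vectors: the oriented area of the parallelogram that they span.\<close>

definition cross :: "complex \<Rightarrow> complex \<Rightarrow> real" where
  "cross a b = Im (cnj a * b)"

text \<open>Positive, zero or negative according to whether \<open>x\<close> lies to the left of, on, or to the right of the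
  oriented line from \<open>P\<close> to \<open>Q\<close>.\<close>

definition side :: "complex \<Rightarrow> complex \<Rightarrow> complex \<Rightarrow> real" where
  "side P Q x = cross (Q - P) (x - P)"

text \<open>The interior of the triangle \<open>ABC\<close>, provided that its vertices are in counterclockwise order.\<close>

definition in_open :: "complex \<Rightarrow> complex \<Rightarrow> complex \<Rightarrow> complex \<Rightarrow> bool" where
  "in_open A B C x \<longleftrightarrow> side A B x > 0 \<and> side B C x > 0 \<and> side C A x > 0"

text \<open>The points that avoid the three lines carrying the sides of the triangle.\<close>

definition off_sides :: "complex \<Rightarrow> complex \<Rightarrow> complex \<Rightarrow> complex \<Rightarrow> bool" where
  "off_sides A B C x \<longleftrightarrow> side A B x \<noteq> 0 \<and> side B C x \<noteq> 0 \<and> side C A x \<noteq> 0"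

lemma cross_altdef: "cross a b = Re a * Im b - Im a * Re b"
  by (simp add: cross_def)

lemma cross_add_right: "cross a (b + c) = cross a b + cross a c"
  and cross_diff_right: "cross a (b - c) = cross a b - cross a c"
  and cross_add_left: "cross (a + b) c = cross a c + cross b c"
  and cross_diff_left: "cross (a - b) c = cross a c - cross b c"
  and cross_scale_right: "cross a (of_real r * b) = r * cross a b"
  and cross_scale_left: "cross (of_real r * a) b = r * cross a b"
  and cross_self [simp]: "cross a a = 0"
  and cross_minus_swap: "cross b a = - cross a b"
  by (simp_all add: cross_altdef algebra_simps)

lemma side_self [simp]: "side P Q P = 0" "side P Q Q = 0"
  by (simp_all add: side_def cross_altdef)

lemma cross_eq_0_imp:
  assumes "cross a b = 0" "a \<noteq> 0"
  shows "\<exists>r. b = of_real r * a"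
proof -
  have "Im (b / a) = 0" using assms(1) by (simp add: cross_altdef Im_divide algebra_simps)
  then have "b / a = of_real (Re (b / a))" by (simp add: complex_eq_iff)
  then have "b = of_real (Re (b / a)) * a" using assms(2) by (simp add: field_simps)
  then show ?thesis by blast
qed

lemma cross_ii_nonzero:
  assumes "cross a b = 0" "a \<noteq> 0" "b \<noteq> 0"
  shows "cross a (\<i> * b) \<noteq> 0"
proof -
  obtain r where r: "b = of_real r * a" using cross_eq_0_imp assms by blast
  then have "r \<noteq> 0" using assms by auto
  have "cross a (\<i> * b) = r * ((Re a)\<^sup>2 + (Im a)\<^sup>2)"
    by (simp add: r cross_altdef power2_eq_square algebra_simps)
  moreover have "(Re a)\<^sup>2 + (Im a)\<^sup>2 \<noteq> 0" using assms(2) by (simp add: complex_eq_iff sum_power2_eq_zero_iff)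
  ultimately show ?thesis using \<open>r \<noteq> 0\<close> by simp
qed

lemma eventually_sgn_eq:
  fixes f :: "'a \<Rightarrow> real"
  assumes "(f \<longlongrightarrow> l) F" "l \<noteq> 0"
  shows "eventually (\<lambda>x. sgn (f x) = sgn l) F"
proof (cases "l > 0")
  case True
  show ?thesis using order_tendstoD(1)[OF assms(1) True] by eventually_elim (use True in simp)
next
  case False
  then have "l < 0" using assms(2) by simp
  show ?thesis using order_tendstoD(2)[OF assms(1) \<open>l < 0\<close>] by eventually_elim (use \<open>l < 0\<close> in simp)
qed

lemma eventually_sgn_quadratic:
  fixes a b c :: real
  shows "eventually (\<lambda>d. sgn (a + b * d + c * d\<^sup>2) =
    (if a \<noteq> 0 then sgn a else if b \<noteq> 0 then sgn b else sgn c)) (at_right 0)"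
proof -
  have pos: "eventually (\<lambda>d::real. d > 0) (at_right 0)" by (simp add: eventually_at_right_less)
  consider "a \<noteq> 0" | "a = 0" "b \<noteq> 0" | "a = 0" "b = 0" by blast
  then show ?thesis
  proof cases
    case 1
    have "((\<lambda>d. a + b * d + c * d\<^sup>2) \<longlongrightarrow> a + b * 0 + c * 0\<^sup>2) (at_right 0)"
      by (intro tendsto_intros)
    from eventually_sgn_eq[OF this] show ?thesis using 1 by simp
  next
    case 2
    have "((\<lambda>d. b + c * d) \<longlongrightarrow> b + c * 0) (at_right 0)"
      by (intro tendsto_intros)
    from eventually_sgn_eq[OF this] 2 have "eventually (\<lambda>d. sgn (b + c * d) = sgn b) (at_right 0)" by simp
    then show ?thesis using pos
    proof eventually_elim
      case (elim d)
      have "b * d + c * d\<^sup>2 = d * (b + c * d)" by (simp add: algebra_simps power2_eq_square)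
      then show ?case using 2 elim by (simp add: sgn_mult)
    qed
  next
    case 3
    show ?thesis using pos by eventually_elim (use 3 in \<open>simp add: sgn_mult\<close>)
  qed
qed

text \<open>Four points near \<open>v\<close>, for \<open>s, t \<in> {1, -1}\<close> and small \<open>d > 0\<close>: a step of order \<open>d\<close> along the line of
  direction \<open>u\<close> through \<open>v\<close>, and a step of order \<open>d\<^sup>2\<close> across it. The different orders make every line avoid these
  points when \<open>d\<close> is small enough.\<close>

definition probe :: "complex \<Rightarrow> complex \<Rightarrow> real \<Rightarrow> real \<Rightarrow> real \<Rightarrow> complex" where
  "probe v u s t d = v + of_real (s * d) * u + of_real (t * d\<^sup>2) * (\<i> * u)"

text \<open>The side of the line \<open>PQ\<close> on which the probe lies for all small \<open>d\<close>; see \<open>eventually_probe_sign\<close>.\<close>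

definition probe_sign :: "complex \<Rightarrow> complex \<Rightarrow> real \<Rightarrow> real \<Rightarrow> complex \<Rightarrow> complex \<Rightarrow> real" where
  "probe_sign v u s t P Q =
    (if side P Q v \<noteq> 0 then sgn (side P Q v)
     else if cross (Q - P) u \<noteq> 0 then sgn (s * cross (Q - P) u)
     else sgn (t * cross (Q - P) (\<i> * u)))"

lemma eventually_probe_sign:
  assumes "s \<noteq> 0"
  shows "eventually (\<lambda>d. sgn (side P Q (probe v u s t d)) = probe_sign v u s t P Q) (at_right 0)"
proof -
  have "side P Q (probe v u s t d) = side P Q v + (s * cross (Q - P) u) * d + (t * cross (Q - P) (\<i> * u)) * d\<^sup>2" for d
    unfolding side_def probe_def add_diff_eq[symmetric] diff_conv_add_uminus
    by (simp add: cross_altdef algebra_simps)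
  moreover have "probe_sign v u s t P Q = (if side P Q v \<noteq> 0 then sgn (side P Q v)
     else if s * cross (Q - P) u \<noteq> 0 then sgn (s * cross (Q - P) u) else sgn (t * cross (Q - P) (\<i> * u)))"
    using assms by (simp add: probe_sign_def)
  ultimately show ?thesis
    using eventually_sgn_quadratic[of "side P Q v" "s * cross (Q - P) u" "t * cross (Q - P) (\<i> * u)"]
    by (simp only:)
qed

lemma probe_sign_nonzero:
  assumes "P \<noteq> Q" "u \<noteq> 0" "s \<noteq> 0" "t \<noteq> 0"
  shows "probe_sign v u s t P Q \<noteq> 0"
  using cross_ii_nonzero[of "Q - P" u] assms by (auto simp: probe_sign_def sgn_zero_iff)

text \<open>The contribution of the directed segment \<open>PQ\<close> at the point \<open>v\<close> of the line of direction \<open>u\<close> through \<open>v\<close>: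
  \<open>1\<close> if the segment lies on that line and ends at \<open>v\<close>, \<open>-1\<close> if it lies on it and starts at \<open>v\<close>.\<close>

definition endpoint_sign :: "complex \<Rightarrow> complex \<Rightarrow> complex \<Rightarrow> complex \<Rightarrow> real" where
  "endpoint_sign v u P Q =
    (if side P Q v = 0 \<and> cross (Q - P) u = 0 then of_bool (Q = v) - of_bool (P = v) else 0)"

text \<open>The indicator of the triangle at the probe, for all small \<open>d\<close>.\<close>

definition probe_in :: "complex \<Rightarrow> complex \<Rightarrow> real \<Rightarrow> real \<Rightarrow> complex \<Rightarrow> complex \<Rightarrow> complex \<Rightarrow> real" where
  "probe_in v u s t A B C = of_bool (probe_sign v u s t A B = 1 \<and> probe_sign v u s t B C = 1 \<and> probe_sign v u s t C A = 1)"

text \<open>The second difference of the indicator of a triangle over the four probes. It annihilates the sides that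
  cross the line, and detects the endpoints of a side on the line.\<close>

definition probe_diff :: "complex \<Rightarrow> complex \<Rightarrow> complex \<Rightarrow> complex \<Rightarrow> complex \<Rightarrow> real" where
  "probe_diff v u A B C = probe_in v u (-1) 1 A B C - probe_in v u (-1) (-1) A B C
     - probe_in v u 1 1 A B C + probe_in v u 1 (-1) A B C"

lemma probe_diff_rotate: "probe_diff v u B C A = probe_diff v u A B C"
  by (simp add: probe_diff_def probe_in_def conj_ac)

lemma probe_diff_edge:
  assumes D: "side A B C > 0" and u: "u \<noteq> 0" and e: "side A B v = 0" "cross (B - A) u = 0"
  shows "probe_diff v u A B C = endpoint_sign v u A B + endpoint_sign v u B C + endpoint_sign v u C A"
proof -
  have AB: "B - A \<noteq> 0" using D by (auto simp: side_def cross_altdef)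
  obtain l where l: "u = of_real l * (B - A)" using cross_eq_0_imp[OF e(2) AB] by blast
  obtain m where "v - A = of_real m * (B - A)" using cross_eq_0_imp[of "B - A" "v - A"] AB e(1) by (auto simp: side_def)
  then have m: "v = A + of_real m * (B - A)" by (simp add: algebra_simps)
  \<comment> \<open>All signs are determined by \<open>l\<close> and by the position \<open>m\<close> of \<open>v\<close> on the line \<open>AB\<close>.\<close>
  have l0: "l \<noteq> 0" using u l by auto
  define K where "K = (Re (B - A))\<^sup>2 + (Im (B - A))\<^sup>2"
  have K: "K > 0" using AB unfolding K_def by (metis complex_eq_0 not_sum_power2_lt_zero linorder_neqE_linordered_idom)
  define E where "E = side A B C"
  have E: "E > 0" using D by (simp add: E_def)
  have s: "side B C v = (1 - m) * E" "side C A v = m * E" "cross (C - B) u = - l * E" "cross (A - C) u = l * E"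
      "cross (B - A) (\<i> * u) = l * K"
    unfolding side_def cross_altdef l m E_def K_def by (simp_all add: algebra_simps power2_eq_square)
  have "v - A = of_real m * (B - A)" "v - B = of_real (m - 1) * (B - A)"
    unfolding m by (simp_all add: algebra_simps)
  then have vA: "v = A \<longleftrightarrow> m = 0" and vB: "v = B \<longleftrightarrow> m = 1"
    using AB by (metis mult_eq_0_iff of_real_eq_0_iff right_minus_eq)+
  have e1: "endpoint_sign v u B C = 0" "endpoint_sign v u C A = 0"
    using l0 E by (simp_all add: endpoint_sign_def s)
  have e2: "endpoint_sign v u A B = of_bool (m = 1) - of_bool (m = 0)"
    using e vA vB by (auto simp: endpoint_sign_def)
  have ps: "probe_sign v u s t A B = sgn t * sgn l"
    "probe_sign v u s t B C = (if m \<noteq> 1 then sgn (1 - m) else - sgn s * sgn l)"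
    "probe_sign v u s t C A = (if m \<noteq> 0 then sgn m else sgn s * sgn l)" for s t
    using e l0 E K by (auto simp: probe_sign_def s sgn_mult)
  show ?thesis
    unfolding e1 e2 probe_diff_def probe_in_def ps
    using l0 by (auto simp: sgn_if)
qed

lemma probe_diff_eq_endpoint_sign:
  assumes D: "side A B C > 0" and u: "u \<noteq> 0"
  shows "probe_diff v u A B C = endpoint_sign v u A B + endpoint_sign v u B C + endpoint_sign v u C A"
proof -
  have D': "side B C A > 0" "side C A B > 0" using D by (simp_all add: side_def cross_altdef algebra_simps)
  consider "side A B v = 0" "cross (B - A) u = 0" | "side B C v = 0" "cross (C - B) u = 0"
    | "side C A v = 0" "cross (A - C) u = 0"
    | "\<not> (side A B v = 0 \<and> cross (B - A) u = 0)" "\<not> (side B C v = 0 \<and> cross (C - B) u = 0)"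
      "\<not> (side C A v = 0 \<and> cross (A - C) u = 0)" by blast
  then show ?thesis
  proof cases
    case 1 then show ?thesis using probe_diff_edge[OF D u] by blast
  next
    case 2 then show ?thesis using probe_diff_edge[OF D'(1) u, of v] 2 probe_diff_rotate[of v u B C A] by linarith
  next
    case 3 then show ?thesis using probe_diff_edge[OF D'(2) u, of v] 3 probe_diff_rotate[of v u A B C] by linarith
  next
    case 4
    have "probe_sign v u s 1 P Q = probe_sign v u s (-1) P Q" if "\<not> (side P Q v = 0 \<and> cross (Q - P) u = 0)" for s P Q
      using that by (auto simp: probe_sign_def)
    then show ?thesis using 4 by (auto simp: probe_diff_def probe_in_def endpoint_sign_def)
  qed
qed

lemma side_line_param:
  assumes "side P Q R = 0" "P \<noteq> Q"
  shows "\<exists>r. R = P + of_real r * (Q - P)"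
proof -
  obtain r where "R - P = of_real r * (Q - P)"
    using cross_eq_0_imp[of "Q - P" "R - P"] assms by (auto simp: side_def)
  then show ?thesis by (intro exI[of _ r]) (simp add: algebra_simps)
qed

lemma same_line_iff:
  assumes "P \<noteq> Q" "P' \<noteq> Q'" "side P Q v = 0"
  shows "{x. side P' Q' x = 0} = {x. side P Q x = 0} \<longleftrightarrow> side P' Q' v = 0 \<and> cross (Q' - P') (Q - P) = 0"
proof
  assume e: "{x. side P' Q' x = 0} = {x. side P Q x = 0}"
  have "P \<in> {x. side P Q x = 0}" "Q \<in> {x. side P Q x = 0}" "v \<in> {x. side P Q x = 0}" using assms by auto
  then have "side P' Q' P = 0" "side P' Q' Q = 0" "side P' Q' v = 0" unfolding e[symmetric] by auto
  then show "side P' Q' v = 0 \<and> cross (Q' - P') (Q - P) = 0"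
    by (simp add: side_def cross_altdef algebra_simps)
next
  assume a: "side P' Q' v = 0 \<and> cross (Q' - P') (Q - P) = 0"
  obtain r where r: "Q - P = of_real r * (Q' - P')" using cross_eq_0_imp[of "Q' - P'" "Q - P"] a assms by auto
  then have "r \<noteq> 0" using assms by auto
  have "side P Q x = side P Q x - side P Q v" for x using assms by simp
  also have "\<dots> x = r * (side P' Q' x - side P' Q' v)" for x
    unfolding side_def r cross_scale_left by (simp add: cross_altdef algebra_simps)
  finally have "side P Q x = r * side P' Q' x" for x using a by simp
  then show "{x. side P' Q' x = 0} = {x. side P Q x = 0}" using \<open>r \<noteq> 0\<close> by auto
qed

text \<open>If at every point of every line as many directed segments (counted with weights) end as start, then
  every function of directed segments that is additive along lines sums to zero over the family. On each line
  such a function is a difference of values of a potential, measured from a base point of the line.\<close>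

lemma sum_line_additive_eq_0:
  fixes P Q :: "'j \<Rightarrow> complex" and \<epsilon> :: "'j \<Rightarrow> real" and E :: "complex \<Rightarrow> complex \<Rightarrow> real"
  assumes fin: "finite J" and ne: "\<And>j. j \<in> J \<Longrightarrow> P j \<noteq> Q j"
    and E: "\<And>z d r s. d \<noteq> 0 \<Longrightarrow> E (z + of_real r * d) (z + of_real s * d) = E z (z + of_real s * d) - E z (z + of_real r * d)"
    and bal: "\<And>v u. u \<noteq> 0 \<Longrightarrow> (\<Sum>j\<in>J. \<epsilon> j * endpoint_sign v u (P j) (Q j)) = 0"
  shows "(\<Sum>j\<in>J. \<epsilon> j * E (P j) (Q j)) = 0"
proof -
  define l where "l j = {x. side (P j) (Q j) x = 0}" for j
  define base :: "complex set \<Rightarrow> complex" where "base m = (SOME z. z \<in> m)" for m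
  have base: "base (l j) \<in> l j" for j
    unfolding base_def by (rule someI[of _ "P j"]) (simp add: l_def)
  define V where "V = P ` J \<union> Q ` J"
  have V: "finite V" using fin by (simp add: V_def)
  define n where "n m v j = (if l j = m then of_bool (Q j = v) - of_bool (P j = v) else 0 :: real)" for m v j
  have split: "E (P j) (Q j) = (\<Sum>m\<in>l ` J. \<Sum>v\<in>V. E (base m) v * n m v j)" if j: "j \<in> J" for j
  proof -
    let ?o = "base (l j)" and ?d = "Q j - P j"
    obtain r where r: "?o = P j + of_real r * ?d" using side_line_param[of "P j" "Q j" ?o] base[of j] ne[OF j] by (auto simp: l_def)
    have "P j = ?o + of_real (- r) * ?d" "Q j = ?o + of_real (1 - r) * ?d" by (simp_all add: r algebra_simps)
    then have "E (P j) (Q j) = E ?o (Q j) - E ?o (P j)" using E[of ?d ?o "- r" "1 - r"] ne[OF j] by simp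
    also have "\<dots> = (\<Sum>v\<in>V. E ?o v * of_bool (Q j = v)) - (\<Sum>v\<in>V. E ?o v * of_bool (P j = v))"
      using V j by (simp add: V_def of_bool_def if_distrib cong: if_cong)
    also have "\<dots> = (\<Sum>v\<in>V. E ?o v * n (l j) v j)"
      by (simp add: n_def sum_subtractf[symmetric] algebra_simps)
    also have "\<dots> = (\<Sum>m\<in>l ` J. if m = l j then (\<Sum>v\<in>V. E (base m) v * n m v j) else 0)"
      using j fin by simp
    also have "\<dots> = (\<Sum>m\<in>l ` J. \<Sum>v\<in>V. E (base m) v * n m v j)"
      by (intro sum.cong refl) (auto simp: n_def)
    finally show ?thesis .
  qed
  have zero: "(\<Sum>j\<in>J. \<epsilon> j * n m v j) = 0" if m: "m \<in> l ` J" for m v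
  proof -
    obtain i where i: "i \<in> J" "m = l i" using m by blast
    show ?thesis
    proof (cases "v \<in> m")
      case True
      have "n m v j = endpoint_sign v (Q i - P i) (P j) (Q j)" if "j \<in> J" for j
        using same_line_iff[of "P i" "Q i" "P j" "Q j" v] True ne[OF that] ne[OF i(1)] i
        by (simp add: n_def endpoint_sign_def l_def)
      then have "(\<Sum>j\<in>J. \<epsilon> j * n m v j) = (\<Sum>j\<in>J. \<epsilon> j * endpoint_sign v (Q i - P i) (P j) (Q j))" by simp
      also have "\<dots> = 0" using bal[of "Q i - P i" v] ne[OF i(1)] by auto
      finally show ?thesis .
    next
      case False
      have "P j \<in> l j" "Q j \<in> l j" for j by (simp_all add: l_def)
      then have "n m v j = 0" for j using False by (auto simp: n_def)
      then show ?thesis by simp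
    qed
  qed
  have "(\<Sum>j\<in>J. \<epsilon> j * E (P j) (Q j)) = (\<Sum>j\<in>J. \<Sum>m\<in>l ` J. \<Sum>v\<in>V. E (base m) v * (\<epsilon> j * n m v j))"
    by (intro sum.cong refl) (simp add: split sum_distrib_left mult.left_commute)
  also have "\<dots> = (\<Sum>m\<in>l ` J. \<Sum>j\<in>J. \<Sum>v\<in>V. E (base m) v * (\<epsilon> j * n m v j))"
    by (rule sum.swap)
  also have "\<dots> = (\<Sum>m\<in>l ` J. \<Sum>v\<in>V. \<Sum>j\<in>J. E (base m) v * (\<epsilon> j * n m v j))"
    by (intro sum.cong refl sum.swap)
  also have "\<dots> = (\<Sum>m\<in>l ` J. \<Sum>v\<in>V. E (base m) v * (\<Sum>j\<in>J. \<epsilon> j * n m v j))"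
    by (simp add: sum_distrib_left)
  also have "\<dots> = 0" by (simp add: zero)
  finally show ?thesis .
qed

text \<open>A weighted family of triangles whose indicators cancel outside the lines of the sides also cancels under
  every boundary sum of a function that is additive along lines. No continuity is required of \<open>E\<close>, and vertices
  of one triangle may lie inside a side of another.\<close>

lemma triangle_valuation_eq_0:
  fixes A B C :: "'i \<Rightarrow> complex" and \<epsilon> :: "'i \<Rightarrow> real" and E :: "complex \<Rightarrow> complex \<Rightarrow> real"
  assumes fin: "finite I" and D: "\<And>i. i \<in> I \<Longrightarrow> side (A i) (B i) (C i) > 0"
    and E: "\<And>z d r s. d \<noteq> 0 \<Longrightarrow> E (z + of_real r * d) (z + of_real s * d) = E z (z + of_real s * d) - E z (z + of_real r * d)"
    and cover: "\<And>x. (\<And>i. i \<in> I \<Longrightarrow> off_sides (A i) (B i) (C i) x) \<Longrightarrow>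
      (\<Sum>i\<in>I. \<epsilon> i * of_bool (in_open (A i) (B i) (C i) x)) = 0"
  shows "(\<Sum>i\<in>I. \<epsilon> i * (E (A i) (B i) + E (B i) (C i) + E (C i) (A i))) = 0"
proof -
  have ne: "A i \<noteq> B i" "B i \<noteq> C i" "C i \<noteq> A i" if "i \<in> I" for i
    using D[OF that] by (auto simp: side_def cross_altdef)
  have probe0: "(\<Sum>i\<in>I. \<epsilon> i * probe_in v u s t (A i) (B i) (C i)) = 0"
    if u: "u \<noteq> 0" and st: "s \<noteq> 0" "t \<noteq> 0" for v u s t
  proof -
    have "eventually (\<lambda>d. \<forall>i\<in>I. sgn (side (A i) (B i) (probe v u s t d)) = probe_sign v u s t (A i) (B i) \<and>
      sgn (side (B i) (C i) (probe v u s t d)) = probe_sign v u s t (B i) (C i) \<and>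
      sgn (side (C i) (A i) (probe v u s t d)) = probe_sign v u s t (C i) (A i)) (at_right 0)"
      using fin by (simp add: eventually_ball_finite_distrib eventually_conj_iff eventually_probe_sign st)
    from eventually_happens[OF this] have "\<exists>d. \<forall>i\<in>I. sgn (side (A i) (B i) (probe v u s t d)) = probe_sign v u s t (A i) (B i) \<and>
      sgn (side (B i) (C i) (probe v u s t d)) = probe_sign v u s t (B i) (C i) \<and>
      sgn (side (C i) (A i) (probe v u s t d)) = probe_sign v u s t (C i) (A i)"
      by (simp add: trivial_limit_at_right_real)
    then obtain d where d: "\<And>i. i \<in> I \<Longrightarrow> sgn (side (A i) (B i) (probe v u s t d)) = probe_sign v u s t (A i) (B i)"
      "\<And>i. i \<in> I \<Longrightarrow> sgn (side (B i) (C i) (probe v u s t d)) = probe_sign v u s t (B i) (C i)"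
      "\<And>i. i \<in> I \<Longrightarrow> sgn (side (C i) (A i) (probe v u s t d)) = probe_sign v u s t (C i) (A i)"
      by blast
    have off: "off_sides (A i) (B i) (C i) (probe v u s t d)" if i: "i \<in> I" for i
      using d[OF i] probe_sign_nonzero[OF _ u st] ne[OF i] unfolding off_sides_def by (metis sgn_0)
    have "in_open (A i) (B i) (C i) (probe v u s t d) \<longleftrightarrow> probe_sign v u s t (A i) (B i) = 1
      \<and> probe_sign v u s t (B i) (C i) = 1 \<and> probe_sign v u s t (C i) (A i) = 1" if i: "i \<in> I" for i
      unfolding in_open_def d[OF i, symmetric] sgn_1_pos ..
    then have "(\<Sum>i\<in>I. \<epsilon> i * probe_in v u s t (A i) (B i) (C i)) =
      (\<Sum>i\<in>I. \<epsilon> i * of_bool (in_open (A i) (B i) (C i) (probe v u s t d)))"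
      by (intro sum.cong refl) (simp add: probe_in_def)
    also have "\<dots> = 0" using cover[OF off] by simp
    finally show ?thesis .
  qed
  define P where "P = (\<lambda>(i, k::nat). if k = 0 then A i else if k = 1 then B i else C i)"
  define Q where "Q = (\<lambda>(i, k::nat). if k = 0 then B i else if k = 1 then C i else A i)"
  have expand: "(\<Sum>j\<in>I \<times> {0, 1, 2}. \<epsilon> (fst j) * F (P j) (Q j)) =
      (\<Sum>i\<in>I. \<epsilon> i * (F (A i) (B i) + F (B i) (C i) + F (C i) (A i)))" for F :: "complex \<Rightarrow> complex \<Rightarrow> real"
    unfolding sum.cartesian_product'
    by (intro sum.cong refl) (simp add: P_def Q_def algebra_simps)
  have "(\<Sum>j\<in>I \<times> {0, 1, 2}. \<epsilon> (fst j) * E (P j) (Q j)) = 0"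
  proof (rule sum_line_additive_eq_0)
    show "finite (I \<times> {0, 1, 2::nat})" using fin by simp
    show "P j \<noteq> Q j" if "j \<in> I \<times> {0, 1, 2}" for j
      using that ne by (auto simp: P_def Q_def)
    show "E (z + of_real r * d) (z + of_real s * d) = E z (z + of_real s * d) - E z (z + of_real r * d)" if "d \<noteq> 0" for z d r s
      using E that by blast
    show "(\<Sum>j\<in>I \<times> {0, 1, 2}. \<epsilon> (fst j) * endpoint_sign v u (P j) (Q j)) = 0" if u: "u \<noteq> 0" for v u
    proof -
      have "(\<Sum>j\<in>I \<times> {0, 1, 2}. \<epsilon> (fst j) * endpoint_sign v u (P j) (Q j)) =
        (\<Sum>i\<in>I. \<epsilon> i * probe_diff v u (A i) (B i) (C i))"
        unfolding expand by (intro sum.cong refl) (simp add: probe_diff_eq_endpoint_sign[OF D u])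
      also have "\<dots> = (\<Sum>i\<in>I. \<epsilon> i * probe_in v u (-1) 1 (A i) (B i) (C i)) - (\<Sum>i\<in>I. \<epsilon> i * probe_in v u (-1) (-1) (A i) (B i) (C i))
         - (\<Sum>i\<in>I. \<epsilon> i * probe_in v u 1 1 (A i) (B i) (C i)) + (\<Sum>i\<in>I. \<epsilon> i * probe_in v u 1 (-1) (A i) (B i) (C i))"
        by (simp add: probe_diff_def algebra_simps sum.distrib sum_subtractf)
      also have "\<dots> = 0" using u by (simp add: probe0)
      finally show ?thesis .
    qed
  qed
  then show ?thesis by (simp only: expand)
qed

section \<open>Tiles and the regular polygon\<close>

lemma side_combination:
  "side P Q (of_real u * A + of_real v * B + of_real w * C) =
    u * side P Q A + v * side P Q B + w * side P Q C" if "u + v + w = 1"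
proof -
  have u: "u = 1 - v - w" using that by simp
  show ?thesis unfolding u by (simp add: side_def cross_altdef algebra_simps)
qed

lemma convex_hull_triangle:
  "x \<in> convex hull {A, B, C} \<longleftrightarrow>
    (\<exists>u v w. 0 \<le> u \<and> 0 \<le> v \<and> 0 \<le> w \<and> u + v + w = 1 \<and> x = of_real u * A + of_real v * B + of_real w * (C::complex))"
  unfolding convex_hull_3 by (auto simp: scaleR_conv_of_real)

lemma in_open_imp_hull:
  assumes D: "side A B C > 0" and x: "in_open A B C x"
  shows "x \<in> convex hull {A, B, C}"
proof -
  let ?D = "side A B C"
  have s: "side B C x + side C A x + side A B x = ?D"
    by (simp add: side_def cross_altdef algebra_simps)
  have "of_real ?D * x = of_real (side B C x) * A + of_real (side C A x) * B + of_real (side A B x) * C"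
    by (simp add: complex_eq_iff side_def cross_altdef algebra_simps)
  then have "x = of_real (side B C x / ?D) * A + of_real (side C A x / ?D) * B + of_real (side A B x / ?D) * C"
    using D by (simp add: field_simps)
  moreover have "side B C x / ?D + side C A x / ?D + side A B x / ?D = 1"
    using s D by (simp add: add_divide_distrib[symmetric])
  ultimately show ?thesis
    unfolding convex_hull_triangle using D x
    by (intro exI[of _ "side B C x / ?D"] exI[of _ "side C A x / ?D"] exI[of _ "side A B x / ?D"])
      (auto simp: in_open_def)
qed

lemma open_in_open: "open {x. in_open A B C x}"
  unfolding in_open_def side_def cross_def by (intro open_Collect_conj open_Collect_less continuous_intros)

lemma in_open_imp_interior:
  assumes "side A B C > 0" "in_open A B C x"
  shows "x \<in> interior (convex hull {A, B, C})"
  by (rule interiorI[OF open_in_open]) (use assms in_open_imp_hull in auto)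

lemma hull_off_sides_imp_in_open:
  assumes D: "side A B C > 0" and x: "x \<in> convex hull {A, B, C}" and off: "off_sides A B C x"
  shows "in_open A B C x"
proof -
  obtain u v w where uvw: "0 \<le> u" "0 \<le> v" "0 \<le> w" "u + v + w = 1" "x = of_real u * A + of_real v * B + of_real w * C"
    using x unfolding convex_hull_triangle by blast
  have "side B C A = side A B C" "side C A B = side A B C"
    by (simp_all add: side_def cross_altdef algebra_simps)
  then have "side A B x = w * side A B C" "side B C x = u * side A B C" "side C A x = v * side A B C"
    by (simp_all add: uvw(5) side_combination[OF uvw(4)])
  then show ?thesis using D off uvw(1-3) by (auto simp: in_open_def off_sides_def order_less_le)
qed

text \<open>The vertices of a tile in counterclockwise order, starting from the one with the angle \<open>\<alpha>\<close>. If the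
  tile lists its vertices clockwise, the second vertex is the one with the angle \<open>\<gamma>\<close>.\<close>

fun first_vertex :: "tile \<Rightarrow> complex" where "first_vertex (A, B, C) = A"
fun second_vertex :: "tile \<Rightarrow> complex" where "second_vertex (A, B, C) = (if side A B C > 0 then B else C)"
fun third_vertex :: "tile \<Rightarrow> complex" where "third_vertex (A, B, C) = (if side A B C > 0 then C else B)"

lemma noncollinear_imp_side:
  assumes "\<not> collinear {A, B, C}"
  shows "side A B C \<noteq> 0"
proof
  assume "side A B C = 0"
  have "A \<noteq> B" using assms by auto
  then obtain r where "C - A = of_real r * (B - A)"
    using cross_eq_0_imp[of "B - A" "C - A"] \<open>side A B C = 0\<close> by (auto simp: side_def)
  then have "C = A + r *\<^sub>R (B - A)" by (simp add: scaleR_conv_of_real algebra_simps)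
  then have "collinear {A, B, C}"
    unfolding collinear_def
    by (intro exI[of _ "B - A"]) (auto intro: exI[of _ 0] exI[of _ 1] exI[of _ "-1"] exI[of _ r] exI[of _ "-r"]  exI[of _ "1-r"] exI[of _ "r-1"] simp: algebra_simps)
  then show False using assms by blast
qed

lemma tile_positive:
  assumes "triangle_with_angles \<alpha> \<beta> \<gamma> t"
  shows "side (first_vertex t) (second_vertex t) (third_vertex t) > 0"
    and "region t = convex hull {first_vertex t, second_vertex t, third_vertex t}"
proof -
  obtain A B C where t: "t = (A, B, C)" by (cases t)
  have "side A B C \<noteq> 0" using noncollinear_imp_side assms t by simp
  moreover have "side A C B = - side A B C" by (simp add: side_def cross_altdef algebra_simps)
  ultimately show "side (first_vertex t) (second_vertex t) (third_vertex t) > 0" by (auto simp: t)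
  show "region t = convex hull {first_vertex t, second_vertex t, third_vertex t}"
    by (auto simp: t insert_commute)
qed

lemma tiling_cover:
  assumes T: "triangle_tiling \<alpha> \<beta> \<gamma> T P"
    and off: "\<And>t. t \<in> T \<Longrightarrow> off_sides (first_vertex t) (second_vertex t) (third_vertex t) x"
  shows "(\<Sum>t\<in>T. of_bool (in_open (first_vertex t) (second_vertex t) (third_vertex t) x)) = (of_bool (x \<in> P) :: real)"
proof -
  let ?in = "\<lambda>t. in_open (first_vertex t) (second_vertex t) (third_vertex t) x"
  have fin: "finite T" and ang: "\<And>t. t \<in> T \<Longrightarrow> triangle_with_angles \<alpha> \<beta> \<gamma> t"
    and disj: "pairwise (\<lambda>s t. interior (region s) \<inter> interior (region t) = {}) T"
    and P: "(\<Union>t\<in>T. region t) = P"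
    using T by (auto simp: triangle_tiling_def)
  have in_iff: "?in t \<longleftrightarrow> x \<in> region t" if "t \<in> T" for t
    using in_open_imp_hull hull_off_sides_imp_in_open tile_positive[OF ang[OF that]] off[OF that] by metis
  have int: "x \<in> interior (region t)" if "t \<in> T" "x \<in> region t" for t
    using in_open_imp_interior in_iff[OF that(1)] tile_positive[OF ang[OF that(1)]] that by metis
  show ?thesis
  proof (cases "x \<in> P")
    case True
    then obtain t where t: "t \<in> T" "x \<in> region t" using P by blast
    have "?in s \<longleftrightarrow> s = t" if "s \<in> T" for s
    proof -
      have "s = t" if "x \<in> region s"
        using disj int[OF \<open>s \<in> T\<close> that] int[OF t] t \<open>s \<in> T\<close> unfolding pairwise_def by blast
      then show ?thesis using in_iff[OF that] t by blast
    qed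
    then have "(\<Sum>s\<in>T. of_bool (?in s)) = (\<Sum>s\<in>T. if s = t then 1 else (0::real))" by (intro sum.cong) auto
    then show ?thesis using True fin t by simp
  next
    case False
    then have "\<not> ?in s" if "s \<in> T" for s using in_iff[OF that] P that by blast
    then show ?thesis using False by simp
  qed
qed

lemma cross_cis:
  "cross (w * cis a) (w * cis b) = (cmod w)\<^sup>2 * sin (b - a)"
proof -
  have "cnj (w * cis a) * (w * cis b) = of_real ((cmod w)\<^sup>2) * cis (b - a)"
    using complex_norm_square[of w] by (simp add: cis_cnj[symmetric] cis_divide[symmetric] divide_inverse cis_inverse algebra_simps)
  then show ?thesis by (simp add: cross_def)
qed

lemma cos_odd_multiple_le:
  fixes m :: int
  assumes N: "N > 1" and m: "1 - int N \<le> m" "m \<le> int N"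
  shows "cos ((2 * m - 1) * pi / N) \<le> cos (pi / N)"
proof -
  define a where "a = \<bar>(2 * m - 1) * pi / N\<bar>"
  have Npos: "real N > 0" using N by simp
  have "1 \<le> \<bar>2 * m - 1\<bar>" "\<bar>2 * m - 1\<bar> \<le> 2 * int N - 1" using m by presburger+
  then have "1 \<le> real_of_int \<bar>2 * m - 1\<bar>" "real_of_int \<bar>2 * m - 1\<bar> \<le> 2 * real N - 1" by linarith+
  moreover have "a = real_of_int \<bar>2 * m - 1\<bar> * (pi / N)" unfolding a_def using Npos by (simp add: abs_mult)
  ultimately have a: "pi / N \<le> a" "a \<le> (2 * real N - 1) * (pi / N)"
    using mult_right_mono[of 1 "real_of_int \<bar>2 * m - 1\<bar>" "pi / N"] mult_right_mono[of "real_of_int \<bar>2 * m - 1\<bar>" "2 * real N - 1" "pi / N"] by simp_all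
  have "(2 * real N - 1) * (pi / N) = 2 * pi - pi / N" using Npos by (simp add: field_simps)
  then have a2: "a \<le> 2 * pi - pi / N" using a by simp
  have q: "0 < pi / N" using Npos by simp
  have "cos a \<le> cos (pi / N)"
  proof (cases "a \<le> pi")
    case True
    then show ?thesis using a q by (intro cos_monotone_0_pi_le) auto
  next
    case False
    then have "cos (2 * pi - a) \<le> cos (pi / N)" using a2 q by (intro cos_monotone_0_pi_le) auto
    then show ?thesis by simp
  qed
  then show ?thesis unfolding a_def by (simp only: cos_abs_real)
qed

text \<open>The regular polygon is also the union of the triangles spanned by its centre and two consecutive vertices.
  The index of the vertices is periodic with period \<open>N\<close>.\<close>

locale regular_polygon =
  fixes N :: nat and c w :: complex
  assumes N: "N > 2" and w: "w \<noteq> 0"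
begin

abbreviation V :: "nat \<Rightarrow> complex" where "V j \<equiv> ngon_vertex c w N j"
abbreviation ngon :: "complex set" where "ngon \<equiv> regular_ngon c w N"

lemma vertex_diff: "V j - c = w * cis (2 * pi * j / N)"
  by (simp add: ngon_vertex_def)

lemma side_center: "side c (V i) (V j) = (cmod w)\<^sup>2 * sin (2 * pi * j / N - 2 * pi * i / N)"
  unfolding side_def vertex_diff cross_cis ..

lemma N_pos: "real N > 0" "2 * pi / N > 0" "2 * pi / N < pi"
  using N by (simp_all add: field_simps)

lemma side_edge:
  "side (V j) (V (j + 1)) (V i) = (cmod w)\<^sup>2 * (2 * sin (pi / N) * (cos (pi / N) - cos ((2 * (int i - int j) - 1) * pi / N)))"
proof -
  have "side (V j) (V (j + 1)) (V i) = side c (V (j + 1)) (V i) - side c (V j) (V i) + side c (V j) (V (j + 1))"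
    by (simp add: side_def cross_altdef algebra_simps)
  also have "\<dots> = (cmod w)\<^sup>2 * (sin (2 * pi * i / N - 2 * pi * (j + 1) / N) - sin (2 * pi * i / N - 2 * pi * j / N) + sin (2 * (pi / N)))"
    unfolding side_center using N_pos by (simp add: algebra_simps add_divide_distrib diff_divide_distrib)
  also have "sin (2 * pi * i / N - 2 * pi * (j + 1) / N) - sin (2 * pi * i / N - 2 * pi * j / N)
      = - 2 * sin (pi / N) * cos ((2 * (int i - int j) - 1) * pi / N)"
  proof -
    define x where "x = (2 * (int i - int j) - 1) * pi / N"
    have "2 * pi * i / N - 2 * pi * (j + 1) / N = x - pi / N" "2 * pi * i / N - 2 * pi * j / N = x + pi / N"
      unfolding x_def using N_pos by (simp_all add: field_simps)
    then show ?thesis unfolding x_def[symmetric] by (simp add: sin_diff sin_add)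
  qed
  also have "sin (2 * (pi / N)) = 2 * sin (pi / N) * cos (pi / N)" by (rule sin_double)
  finally show ?thesis by (simp add: algebra_simps)
qed

lemma half_plane:
  assumes j: "j \<in> {1..N}" and x: "x \<in> ngon"
  shows "side (V j) (V (j + 1)) x \<ge> 0"
proof -
  have "V ` {1..N} \<subseteq> {x. side (V j) (V (j + 1)) x \<ge> 0}"
  proof clarify
    fix i assume i: "i \<in> {1..N}"
    have "cos ((2 * (int i - int j) - 1) * pi / N) \<le> cos (pi / N)"
      using cos_odd_multiple_le[of N "int i - int j"] N i j by simp
    moreover have "sin (pi / N) \<ge> 0" using N_pos by (intro sin_ge_zero) (auto simp: field_simps)
    ultimately show "side (V j) (V (j + 1)) (V i) \<ge> 0" unfolding side_edge by simp
  qed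
  moreover have "convex {x. side (V j) (V (j + 1)) x \<ge> 0}"
  proof -
    have "{x. side (V j) (V (j + 1)) x \<ge> 0} = {x. inner (\<i> * (V (j + 1) - V j)) x \<ge> inner (\<i> * (V (j + 1) - V j)) (V j)}"
      by (auto simp: side_def cross_altdef inner_complex_def algebra_simps)
    then show ?thesis by (simp add: convex_halfspace_ge)
  qed
  ultimately have "ngon \<subseteq> {x. side (V j) (V (j + 1)) x \<ge> 0}"
    unfolding regular_ngon_def by (rule hull_minimal)
  then show ?thesis using x by blast
qed

lemma vertex_periodic: "V (N + j) = V j"
proof -
  have "2 * pi * (N + j) / N = 2 * pi * j / N + 2 * pi" using N_pos by (simp add: field_simps)
  then show ?thesis by (simp add: ngon_vertex_def cis.code)
qed

lemma vertex_in: "j \<in> {1..N + 1} \<Longrightarrow> V j \<in> ngon"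
proof -
  assume j: "j \<in> {1..N + 1}"
  have "V j \<in> V ` {1..N}"
  proof (cases "j = N + 1")
    case True then show ?thesis using vertex_periodic[of 1] N by auto
  qed (use j in auto)
  then show ?thesis unfolding regular_ngon_def by (rule hull_inc)
qed

lemma center_in: "c \<in> ngon"
proof -
  have cx: "convex ngon" by (simp add: regular_ngon_def convex_convex_hull)
  have "(\<Sum>j\<in>{1..N}. (1 / N) *\<^sub>R V j) \<in> ngon"
    by (rule convex_sum[OF _ cx]) (use N vertex_in in auto)
  moreover have "(\<Sum>j\<in>{1..N}. (1 / N) *\<^sub>R V j) = c"
  proof -
    let ?z = "cis (2 * pi / N)"
    have "N * (2 * pi / N) = 2 * pi" using N_pos by simp
    then have "?z ^ N = cis (2 * pi)" by (simp only: Complex.DeMoivre)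
    then have zN: "?z ^ N = 1" by (simp only: cis_2pi)
    have z1: "?z \<noteq> 1"
    proof
      assume "?z = 1"
      then have "sin (2 * pi / N) = 0" by (simp add: complex_eq_iff)
      then show False using sin_gt_zero[OF N_pos(2,3)] by simp
    qed
    have "(\<Sum>j\<in>{1..N}. ?z ^ j) = (\<Sum>j<N. ?z ^ Suc j)"
      by (rule sum.reindex_bij_witness[of _ Suc "\<lambda>j. j - 1"]) auto
    also have "\<dots> = ?z * (\<Sum>j<N. ?z ^ j)" by (simp add: sum_distrib_left)
    also have "(\<Sum>j<N. ?z ^ j) = 0" using z1 by (simp add: geometric_sum zN)
    finally have s: "(\<Sum>j\<in>{1..N}. ?z ^ j) = 0" by simp
    have "V j = c + w * ?z ^ j" for j by (simp add: ngon_vertex_def Complex.DeMoivre mult.commute)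
    then have "(\<Sum>j\<in>{1..N}. V j) = of_nat N * c + w * (\<Sum>j\<in>{1..N}. ?z ^ j)"
      by (simp add: sum.distrib sum_distrib_left)
    then have "(\<Sum>j\<in>{1..N}. V j) = of_nat N * c" by (simp only: s mult_zero_right add_0_right)
    then have "(1 / N) *\<^sub>R (\<Sum>j\<in>{1..N}. V j) = c" using N by (simp add: scaleR_conv_of_real)
    then show ?thesis by (simp add: scaleR_sum_right)
  qed
  ultimately show ?thesis by simp
qed

lemma center_triangle_positive: "side c (V j) (V (j + 1)) > 0"
proof -
  have "2 * pi * real (j + 1) / N - 2 * pi * j / N = 2 * pi / N" using N_pos by (simp add: field_simps)
  then have "side c (V j) (V (j + 1)) = (cmod w)\<^sup>2 * sin (2 * pi / N)" unfolding side_center by (simp only:)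
  then show ?thesis using sin_gt_zero[OF N_pos(2,3)] w by simp
qed

lemma center_triangle_subset:
  assumes "j \<in> {1..N}" "in_open c (V j) (V (j + 1)) x"
  shows "x \<in> ngon"
proof -
  have "convex hull {c, V j, V (j + 1)} \<subseteq> ngon"
    using center_in vertex_in[of j] vertex_in[of "j + 1"] assms(1)
    by (intro hull_minimal) (auto simp: regular_ngon_def convex_convex_hull)
  then show ?thesis using in_open_imp_hull[OF center_triangle_positive assms(2)] by blast
qed

end

lemma sin_pos_sector:
  fixes \<phi> \<delta> :: real
  assumes "0 < \<delta>" "\<delta> < pi" "-2 * pi < \<phi>" "\<phi> < 2 * pi"
  shows "sin \<phi> > 0 \<and> sin (\<delta> - \<phi>) > 0 \<longleftrightarrow> 0 < \<phi> \<and> \<phi> < \<delta> \<or> 0 < \<phi> + 2 * pi \<and> \<phi> + 2 * pi < \<delta>"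
proof -
  have base: "sin \<psi> > 0 \<and> sin (\<delta> - \<psi>) > 0 \<longleftrightarrow> \<psi> < \<delta>" if "0 < \<psi>" "\<psi> < 2 * pi" for \<psi>
  proof
    assume a: "sin \<psi> > 0 \<and> sin (\<delta> - \<psi>) > 0"
    then have "\<psi> < pi" using that sin_le_zero[of \<psi>] by force
    show "\<psi> < \<delta>"
    proof (rule ccontr)
      assume "\<not> \<psi> < \<delta>"
      then have "sin (\<psi> - \<delta>) \<ge> 0" using assms \<open>\<psi> < pi\<close> by (intro sin_ge_zero) auto
      moreover have "sin (\<delta> - \<psi>) = - sin (\<psi> - \<delta>)" by (metis minus_diff_eq sin_minus)
      ultimately show False using a by simp
    qed
  next
    assume "\<psi> < \<delta>"
    then show "sin \<psi> > 0 \<and> sin (\<delta> - \<psi>) > 0" using that assms by (auto intro!: sin_gt_zero)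
  qed
  consider "0 < \<phi>" | "\<phi> = 0" | "\<phi> < 0" by linarith
  then show ?thesis
  proof cases
    case 1 then show ?thesis using base[of \<phi>] assms by auto
  next
    case 2 then show ?thesis using assms by auto
  next
    case 3
    have e: "\<delta> - \<phi> = \<delta> - (\<phi> + 2 * pi) + 2 * pi" by simp
    have "sin (\<delta> - \<phi>) = sin (\<delta> - (\<phi> + 2 * pi))" by (subst e) (rule sin_periodic)
    then have "sin \<phi> > 0 \<and> sin (\<delta> - \<phi>) > 0 \<longleftrightarrow> sin (\<phi> + 2 * pi) > 0 \<and> sin (\<delta> - (\<phi> + 2 * pi)) > 0"
      by (simp only: sin_periodic)
    also have "\<dots> \<longleftrightarrow> \<phi> + 2 * pi < \<delta>" by (rule base) (use assms 3 in auto)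
    finally show ?thesis using assms 3 by auto
  qed
qed

context regular_polygon
begin

text \<open>A point that avoids the lines of the central triangles lies in exactly one of the \<open>N\<close> open sectors.\<close>

lemma ex1_sector:
  assumes off: "\<And>j. j \<in> {1..N} \<Longrightarrow> off_sides c (V j) (V (j + 1)) x"
  shows "\<exists>j\<in>{1..N}. \<forall>i\<in>{1..N}. side c (V i) x > 0 \<and> side (V (i + 1)) c x > 0 \<longleftrightarrow> i = j"
proof -
  define \<delta> where "\<delta> = 2 * pi / N"
  have \<delta>: "0 < \<delta>" "\<delta> < pi" using N_pos by (simp_all add: \<delta>_def)
  have N\<delta>: "N * \<delta> = 2 * pi" using N_pos by (simp add: \<delta>_def)
  define y where "y = (x - c) / w"
  have x: "x - c = w * y" using w by (simp add: y_def)
  have y0: "y \<noteq> 0"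
  proof
    assume "y = 0"
    then have "x = c" using x by simp
    then show False using off[of 1] N by (auto simp: off_sides_def)
  qed
  define \<theta> where "\<theta> = Arg2pi y"
  have \<theta>: "0 \<le> \<theta>" "\<theta> < 2 * pi" "y = of_real (norm y) * cis \<theta>"
    using Arg2pi[of y] unfolding \<theta>_def cis_conv_exp is_Arg_def by blast+
  have Vd: "V i - c = w * cis (i * \<delta>)" for i by (simp add: vertex_diff \<delta>_def mult.commute)
  have s1: "side c (V i) x = norm y * (cmod w)\<^sup>2 * sin (\<theta> - i * \<delta>)" for i
  proof -
    have "side c (V i) x = cross (w * cis (i * \<delta>)) (of_real (norm y) * (w * cis \<theta>))"
      unfolding side_def Vd x by (subst \<theta>(3)) (simp only: mult.left_commute)
    then show ?thesis by (simp add: cross_scale_right cross_cis)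
  qed
  have s2: "side (V i) c x = - side c (V i) x" for i
    by (simp add: side_def cross_altdef algebra_simps)
  have K: "norm y * (cmod w)\<^sup>2 > 0" using y0 w by simp
  have sec: "side c (V i) x > 0 \<and> side (V (i + 1)) c x > 0 \<longleftrightarrow>
      0 < \<theta> - i * \<delta> \<and> \<theta> - i * \<delta> < \<delta> \<or> 0 < \<theta> - i * \<delta> + 2 * pi \<and> \<theta> - i * \<delta> + 2 * pi < \<delta>"
    if i: "i \<in> {1..N}" for i
  proof -
    have "- sin (\<theta> - (i + 1) * \<delta>) = sin (\<delta> - (\<theta> - i * \<delta>))"
      by (subst sin_minus[symmetric]) (simp add: algebra_simps)
    then have a: "side (V (i + 1)) c x = norm y * (cmod w)\<^sup>2 * sin (\<delta> - (\<theta> - i * \<delta>))"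
      unfolding s2 s1 by (metis mult_minus_right)
    have *: "i * \<delta> \<le> N * \<delta>" "0 < i * \<delta>" using i \<delta> by auto
    have "i * \<delta> < N * \<delta>" if "i \<noteq> N" using i \<delta> that by auto
    then have "- 2 * pi < \<theta> - i * \<delta>" "\<theta> - i * \<delta> < 2 * pi" if "\<theta> \<noteq> 0 \<or> i \<noteq> N"
      using \<theta>(1,2) N\<delta> that * by linarith+
    moreover have "\<not> (\<theta> = 0 \<and> i = N)"
    proof
      assume "\<theta> = 0 \<and> i = N"
      then have "side c (V N) x = 0" unfolding s1 by (simp add: N\<delta>)
      then show False using off[of N] N by (auto simp: off_sides_def)
    qed
    ultimately have b: "- 2 * pi < \<theta> - i * \<delta>" "\<theta> - i * \<delta> < 2 * pi" by blast+
    have pos: "r > 0 \<Longrightarrow> r * z > 0 \<longleftrightarrow> z > 0" for r z :: real by (simp add: zero_less_mult_iff)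
    show ?thesis unfolding a unfolding s1 pos[OF K] by (rule sin_pos_sector[OF \<delta> b])
  qed
  define m where "m = nat \<lfloor>\<theta> / \<delta>\<rfloor>"
  have "real m = of_int \<lfloor>\<theta> / \<delta>\<rfloor>" unfolding m_def using \<theta>(1) \<delta> by simp
  then have "real m \<le> \<theta> / \<delta>" "\<theta> / \<delta> < real m + 1" by linarith+
  then have m1: "m * \<delta> \<le> \<theta>" "\<theta> < m * \<delta> + \<delta>" using \<delta> by (simp_all add: field_simps)
  have mN: "m < N"
  proof -
    have "m * \<delta> < N * \<delta>" using m1 \<theta>(1,2) N\<delta> by linarith
    then show ?thesis using \<delta> by simp
  qed
  define j where "j = (if m = 0 then N else m)"
  have j: "j \<in> {1..N}" using mN N by (auto simp: j_def)
  have mne: "m * \<delta> \<noteq> \<theta>"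
  proof
    assume e: "m * \<delta> = \<theta>"
    have "sin (\<theta> - j * \<delta>) = 0"
      using e by (auto simp: j_def N\<delta>)
    then have "side c (V j) x = 0" unfolding s1 by simp
    then show False using off[OF j] by (auto simp: off_sides_def)
  qed
  have uniq: "0 < \<theta> - k * \<delta> \<and> \<theta> - k * \<delta> < \<delta> \<longleftrightarrow> k = m" if "k \<ge> 0" for k :: int
  proof
    assume a: "0 < \<theta> - k * \<delta> \<and> \<theta> - k * \<delta> < \<delta>"
    have "k * \<delta> < (m + 1) * \<delta>" "m * \<delta> < (k + 1) * \<delta>" using a m1 by (simp_all add: algebra_simps)
    then have "real_of_int k < real m + 1" "real m < real_of_int k + 1" using \<delta> by simp_all
    then show "k = m" by linarith
  qed (use m1 mne in auto)
  have "side c (V i) x > 0 \<and> side (V (i + 1)) c x > 0 \<longleftrightarrow> i = j" if i: "i \<in> {1..N}" for i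
  proof -
    have e1: "0 < \<theta> - i * \<delta> \<and> \<theta> - i * \<delta> < \<delta> \<longleftrightarrow> i = m" using uniq[of "int i"] by simp
    have e2: "0 < \<theta> - i * \<delta> + 2 * pi \<and> \<theta> - i * \<delta> + 2 * pi < \<delta> \<longleftrightarrow> i = N \<and> m = 0"
    proof (cases "i = N")
      case True
      then show ?thesis using uniq[of 0] N\<delta> by auto
    next
      case False
      then have "real i + 1 \<le> N" using i by auto
      then have "(real i + 1) * \<delta> \<le> N * \<delta>" using \<delta> by (intro mult_right_mono) auto
      then have "i * \<delta> + \<delta> \<le> 2 * pi" using N\<delta> by (simp add: algebra_simps)
      then show ?thesis using \<theta>(1,2) False by auto
    qed
    show ?thesis unfolding sec[OF i] e1 e2 using i mN by (auto simp: j_def)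
  qed
  then show ?thesis using j by blast
qed

lemma ngon_cover:
  assumes off: "\<And>j. j \<in> {1..N} \<Longrightarrow> off_sides c (V j) (V (j + 1)) x"
  shows "(\<Sum>j\<in>{1..N}. of_bool (in_open c (V j) (V (j + 1)) x)) = (of_bool (x \<in> ngon) :: real)"
proof -
  obtain j where j: "j \<in> {1..N}" and s: "\<And>i. i \<in> {1..N} \<Longrightarrow> side c (V i) x > 0 \<and> side (V (i + 1)) c x > 0 \<longleftrightarrow> i = j"
    using ex1_sector[OF off] by blast
  have "in_open c (V j) (V (j + 1)) x \<longleftrightarrow> x \<in> ngon"
  proof
    assume "x \<in> ngon"
    then have "side (V j) (V (j + 1)) x > 0" using half_plane[OF j] off[OF j] by (auto simp: off_sides_def order_less_le)
    then show "in_open c (V j) (V (j + 1)) x" using s[OF j] by (auto simp: in_open_def)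
  qed (rule center_triangle_subset[OF j])
  then have "in_open c (V i) (V (i + 1)) x \<longleftrightarrow> i = j \<and> x \<in> ngon" if "i \<in> {1..N}" for i
    using s[OF that] by (auto simp: in_open_def)
  then have "(\<Sum>i\<in>{1..N}. of_bool (in_open c (V i) (V (i + 1)) x)) = (\<Sum>i\<in>{1..N}. if i = j then of_bool (x \<in> ngon) else (0::real))"
    by (intro sum.cong) auto
  then show ?thesis using j by simp
qed

text \<open>The tiles, with weight \<open>1\<close>, and the central triangles of the polygon, with weight \<open>-1\<close>, have cancelling
  indicators, hence equal boundary sums.\<close>

lemma tiling_valuation:
  fixes E :: "complex \<Rightarrow> complex \<Rightarrow> real"
  assumes T: "triangle_tiling \<alpha> \<beta> \<gamma> T ngon"
    and E: "\<And>z d r s. d \<noteq> 0 \<Longrightarrow> E (z + of_real r * d) (z + of_real s * d) = E z (z + of_real s * d) - E z (z + of_real r * d)"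
  shows "(\<Sum>t\<in>T. E (first_vertex t) (second_vertex t) + E (second_vertex t) (third_vertex t) + E (third_vertex t) (first_vertex t))
    = (\<Sum>j\<in>{1..N}. E c (V j) + E (V j) (V (j + 1)) + E (V (j + 1)) c)"
proof -
  have fin: "finite T" and ang: "\<And>t. t \<in> T \<Longrightarrow> triangle_with_angles \<alpha> \<beta> \<gamma> t"
    using T by (auto simp: triangle_tiling_def)
  define A where "A = case_sum first_vertex (\<lambda>j::nat. c)"
  define B where "B = case_sum second_vertex V"
  define C where "C = case_sum third_vertex (\<lambda>j. V (j + 1))"
  define \<epsilon> :: "tile + nat \<Rightarrow> real" where "\<epsilon> = case_sum (\<lambda>t. 1) (\<lambda>j. -1)"
  let ?I = "T <+> {1..N}"
  have split: "(\<Sum>i\<in>?I. \<epsilon> i * F i) = (\<Sum>t\<in>T. F (Inl t)) - (\<Sum>j\<in>{1..N}. F (Inr j))" for F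
    using fin by (simp add: sum.Plus \<epsilon>_def sum_negf)
  have "(\<Sum>i\<in>?I. \<epsilon> i * (E (A i) (B i) + E (B i) (C i) + E (C i) (A i))) = 0"
  proof (rule triangle_valuation_eq_0)
    show "finite ?I" using fin by simp
    show "side (A i) (B i) (C i) > 0" if "i \<in> ?I" for i
      using that tile_positive[OF ang] center_triangle_positive by (auto simp: A_def B_def C_def)
    show "E (z + of_real r * d) (z + of_real s * d) = E z (z + of_real s * d) - E z (z + of_real r * d)" if "d \<noteq> 0" for z d r s
      using E that by blast
    fix x assume off: "\<And>i. i \<in> ?I \<Longrightarrow> off_sides (A i) (B i) (C i) x"
    have "off_sides (first_vertex t) (second_vertex t) (third_vertex t) x" if "t \<in> T" for t
      using off[of "Inl t"] that by (auto simp: A_def B_def C_def)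
    moreover have "off_sides c (V j) (V (j + 1)) x" if "j \<in> {1..N}" for j
      using off[OF InrI[OF that]] by (simp add: A_def B_def C_def)
    ultimately show "(\<Sum>i\<in>?I. \<epsilon> i * of_bool (in_open (A i) (B i) (C i) x)) = 0"
      unfolding split using tiling_cover[OF T, of x] ngon_cover[of x] by (simp add: A_def B_def C_def)
  qed
  then show ?thesis unfolding split by (simp add: A_def B_def C_def)
qed

end

section \<open>Angles of triangles\<close>

lemma angle_at_sym: "angle_at A C B = angle_at A B C"
  by (simp add: angle_at_def inner_commute mult.commute)

lemma angle_at_cis:
  assumes "side A B C > 0"
  shows "cis (angle_at A B C) = sgn ((C - A) / (B - A))" "0 < angle_at A B C" "angle_at A B C < pi"
proof -
  define z where "z = (C - A) / (B - A)"
  have ne: "B - A \<noteq> 0" "C - A \<noteq> 0" using assms by (auto simp: side_def cross_altdef)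
  have n: "norm z = norm (C - A) / norm (B - A)" by (simp add: z_def norm_divide)
  have z0: "norm z > 0" using ne by (simp add: z_def)
  have C: "C - A = z * (B - A)" using ne by (simp add: z_def)
  have in1: "(B - A) \<bullet> (C - A) = (norm (B - A))\<^sup>2 * Re z"
    unfolding C inner_complex_def cmod_power2 by (simp add: algebra_simps power2_eq_square)
  have "side A B C = (norm (B - A))\<^sup>2 * Im z"
    unfolding side_def C cross_altdef cmod_power2 by (simp add: algebra_simps power2_eq_square)
  then have im: "Im z > 0" using assms ne by (simp add: zero_less_mult_iff)
  have "(B - A) \<bullet> (C - A) / (norm (B - A) * norm (C - A)) = Re z / norm z"
    unfolding in1 n using ne by (simp add: field_simps power2_eq_square)
  then have ang: "angle_at A B C = arccos (Re z / norm z)" by (simp add: angle_at_def z_def)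
  have sq: "(Re z / norm z)\<^sup>2 + (Im z / norm z)\<^sup>2 = 1"
    
  proof -
    have "(Re z / norm z)\<^sup>2 + (Im z / norm z)\<^sup>2 = ((Re z)\<^sup>2 + (Im z)\<^sup>2) / (norm z)\<^sup>2"
      by (simp only: power_divide add_divide_distrib)
    also have "\<dots> = 1" unfolding cmod_power2[symmetric] using z0 by simp
    finally show ?thesis .
  qed
  have r: "(Re z / norm z)\<^sup>2 < 1" 
  proof -
    have "(Im z / norm z)\<^sup>2 > 0" using im z0 by (intro zero_less_power divide_pos_pos)
    then show ?thesis using sq by linarith
  qed
  then have r1: "-1 < Re z / norm z" "Re z / norm z < 1"
    using abs_square_less_1[of "Re z / norm z"] by linarith+
  show "0 < angle_at A B C" "angle_at A B C < pi" unfolding ang using arccos_lt_bounded[OF r1] by auto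
  have "sin (arccos (Re z / norm z)) = sqrt (1 - (Re z / norm z)\<^sup>2)"
    using r1 by (intro sin_arccos) auto
  also have "\<dots> = Im z / norm z"
  proof (rule real_sqrt_unique)
    show "(Im z / norm z)\<^sup>2 = 1 - (Re z / norm z)\<^sup>2" using sq by linarith
    show "0 \<le> Im z / norm z" using im z0 by (intro divide_nonneg_nonneg) linarith+
  qed
  finally have "cis (angle_at A B C) = Complex (Re z / norm z) (Im z / norm z)"
    unfolding ang using r1 by (simp add: complex_eq_iff)
  also have "\<dots> = sgn z" by (simp add: sgn_eq complex_eq_iff)
  finally show "cis (angle_at A B C) = sgn ((C - A) / (B - A))" by (simp add: z_def)
qed

lemma side_rotate: "side B C A = side A B C" "side C A B = side A B C"
  by (simp_all add: side_def cross_altdef algebra_simps)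

lemma triangle_angle_sum:
  assumes D: "side A B C > 0"
  shows "angle_at A B C + angle_at B C A + angle_at C A B = pi"
proof -
  have D': "side B C A > 0" "side C A B > 0" using D by (simp_all add: side_rotate)
  note a = angle_at_cis[OF D] and b = angle_at_cis[OF D'(1)] and c = angle_at_cis[OF D'(2)]
  let ?s = "angle_at A B C + angle_at B C A + angle_at C A B"
  have ne: "A \<noteq> B" "B \<noteq> C" "C \<noteq> A" using D by (auto simp: side_def cross_altdef)
  have "cis ?s = cis (angle_at A B C) * cis (angle_at B C A) * cis (angle_at C A B)"
    by (simp add: cis_mult)
  also have "\<dots> = sgn ((C - A) / (B - A) * ((A - B) / (C - B)) * ((B - C) / (A - C)))"
    by (simp only: a b c sgn_mult)
  also have "(C - A) / (B - A) * ((A - B) / (C - B)) * ((B - C) / (A - C)) = -1"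
    using ne by (simp add: divide_simps) (simp add: algebra_simps)
  finally have "cis ?s = -1" by simp
  then have "cos ?s = -1" by (simp add: complex_eq_iff)
  then have "cos (?s - pi) = 1" by simp
  moreover have "cos (?s - pi) < 1" if "?s \<noteq> pi"
  proof -
    have "\<bar>?s - pi\<bar> < 2 * pi" "\<bar>?s - pi\<bar> > 0" using a(2,3) b(2,3) c(2,3) that by linarith+
    then have "sin (\<bar>?s - pi\<bar> / 2) > 0" by (intro sin_gt_zero) auto
    then have "cos \<bar>?s - pi\<bar> < 1" using cos_double_sin[of "\<bar>?s - pi\<bar> / 2"] by simp
    then show ?thesis by (simp only: cos_abs_real)
  qed
  ultimately show ?thesis by fastforce
qed

lemma cis_double_angle:
  assumes "side A B C > 0"
  shows "cis (2 * angle_at A B C) = (C - A) * cnj (B - A) / (cnj (C - A) * (B - A))"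
proof -
  define z where "z = (C - A) / (B - A)"
  have ne: "B - A \<noteq> 0" "C - A \<noteq> 0" using assms by (auto simp: side_def cross_altdef)
  have "cis (2 * angle_at A B C) = (sgn z)\<^sup>2"
    unfolding mult_2 cis_mult[symmetric] angle_at_cis(1)[OF assms] by (simp add: z_def power2_eq_square)
  also have "\<dots> = z\<^sup>2 / of_real ((norm z)\<^sup>2)" by (simp add: sgn_eq power_divide)
  also have "\<dots> = z / cnj z" unfolding complex_norm_square using ne by (simp add: z_def power2_eq_square)
  finally show ?thesis by (simp add: z_def)
qed

text \<open>The shape of a counterclockwise triangle, written with the squares \<open>cis (2 \<beta>)\<close> and \<open>cis (2 \<gamma>)\<close> only: these are
  roots of unity of the order that is needed, while \<open>cis \<beta>\<close> and \<open>sin \<beta>\<close> may lie outside the cyclotomic field.\<close>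

lemma positive_triangle_similarity:
  assumes D: "side A B C > 0"
  shows "(C - A) * (cis (2 * angle_at C A B) - 1) = (B - A) * (cis (- (2 * angle_at B C A)) - 1)"
proof -
  have D': "side B C A > 0" "side C A B > 0" using D by (simp_all add: side_rotate)
  have ne: "B - A \<noteq> 0" "C - A \<noteq> 0" "C - B \<noteq> 0" using D by (auto simp: side_def cross_altdef)
  have "cis (- (2 * angle_at B C A)) = inverse (cis (2 * angle_at B C A))" by (simp add: cis_inverse)
  also have "\<dots> = (cnj (A - B) * (C - B)) / ((A - B) * cnj (C - B))" unfolding cis_double_angle[OF D'(1)] by simp
  finally have b: "cis (- (2 * angle_at B C A)) = (cnj (A - B) * (C - B)) / ((A - B) * cnj (C - B))" .
  define X Y where "X = B - A" and "Y = C - A"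
  define X' Y' where "X' = cnj X" and "Y' = cnj Y"
  have e: "A - B = - X" "C - B = Y - X" "B - C = X - Y" "A - C = - Y" by (simp_all add: X_def Y_def)
  have ne': "X \<noteq> 0" "Y \<noteq> 0" "X' \<noteq> 0" "Y' \<noteq> 0" "Y - X \<noteq> 0" "X - Y \<noteq> 0"
    using ne by (auto simp: X_def Y_def X'_def Y'_def)
  have "cnj (Y - X) \<noteq> 0" "cnj (X - Y) \<noteq> 0" using ne' by (simp_all only: complex_cnj_zero_iff not_False_eq_True)
  then have ne2: "Y' - X' \<noteq> 0" "X' - Y' \<noteq> 0" by (simp_all add: X'_def Y'_def)
  have cancel: "a * (b / (d * a) - 1) = b / d - a" if "a \<noteq> 0" for a b d :: complex
    using that by (simp add: right_diff_distrib)
  have "Y * ((X - Y) * Y' / ((X' - Y') * Y) - 1) = (X - Y) * Y' / (X' - Y') - Y"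
    by (rule cancel[OF ne'(2)])
  also have "\<dots> = ((X - Y) * Y' - Y * (X' - Y')) / (X' - Y')" using ne2 by (simp add: diff_divide_distrib)
  also have "\<dots> = (X' * (Y - X) - X * (Y' - X')) / (Y' - X')"
    using ne2 by (simp add: frac_eq_eq) (simp add: algebra_simps)
  also have "\<dots> = X' * (Y - X) / (Y' - X') - X" using ne2 by (simp add: diff_divide_distrib)
  also have "\<dots> = X * ((X' * (Y - X)) / (X * (Y' - X')) - 1)"
    unfolding cancel[OF ne'(1), symmetric] by (simp only: mult.commute[of X "Y' - X'"])
  finally have eq: "Y * ((X - Y) * Y' / ((X' - Y') * Y) - 1) = X * ((X' * (Y - X)) / (X * (Y' - X')) - 1)" .
  have c1: "cnj (X - Y) = X' - Y'" "cnj (- Y) = - Y'" "cnj (- X) = - X'" "cnj (Y - X) = Y' - X'" by (simp_all add: X'_def Y'_def)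
  have "(X - Y) * - Y' / ((X' - Y') * - Y) = (X - Y) * Y' / ((X' - Y') * Y)"
    "- X' * (Y - X) / (- X * (Y' - X')) = X' * (Y - X) / (X * (Y' - X'))" by simp_all
  then show ?thesis using eq
    unfolding cis_double_angle[OF D'(2)] b e X_def[symmetric] Y_def[symmetric] c1 by (simp only:)
qed

text \<open>The angles \<open>\<beta>\<close> and \<open>\<gamma>\<close> are exchanged if the tile lists its vertices clockwise.\<close>

lemma tile_similarity:
  assumes "triangle_with_angles \<alpha> \<beta> \<gamma> t"
  shows "\<exists>\<mu> \<nu>. (\<mu>, \<nu>) \<in> {(\<beta>, \<gamma>), (\<gamma>, \<beta>)} \<and>
    (third_vertex t - first_vertex t) * (cis (2 * \<nu>) - 1) = (second_vertex t - first_vertex t) * (cis (- (2 * \<mu>)) - 1)"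
proof -
  obtain A B C where t: "t = (A, B, C)" by (cases t)
  have ang: "angle_at B C A = \<beta>" "angle_at C A B = \<gamma>" "angle_at B A C = \<beta>" "angle_at C B A = \<gamma>"
    using assms t by (auto simp: angle_at_sym)
  show ?thesis
  proof (cases "side A B C > 0")
    case True
    show ?thesis using positive_triangle_similarity[OF True] True
      by (intro exI[of _ \<beta>] exI[of _ \<gamma>]) (simp add: t ang)
  next
    case False
    then have pos: "side A C B > 0" using tile_positive(1)[OF assms] by (simp add: t)
    show ?thesis using positive_triangle_similarity[OF pos] False
      by (intro exI[of _ \<gamma>] exI[of _ \<beta>]) (simp add: t ang)
  qed
qed

lemma tile_angles:
  assumes "triangle_with_angles \<alpha> \<beta> \<gamma> t"
  shows "\<alpha> + \<beta> + \<gamma> = pi" "0 < \<beta>" "\<beta> < pi" "0 < \<gamma>" "\<gamma> < pi"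
proof -
  obtain A B C where t: "t = (A, B, C)" by (cases t)
  have ang: "angle_at A B C = \<alpha>" "angle_at B C A = \<beta>" "angle_at C A B = \<gamma>"
    "angle_at A C B = \<alpha>" "angle_at B A C = \<beta>" "angle_at C B A = \<gamma>"
    using assms t by (auto simp: angle_at_sym)
  have "\<alpha> + \<beta> + \<gamma> = pi \<and> 0 < \<beta> \<and> \<beta> < pi \<and> 0 < \<gamma> \<and> \<gamma> < pi"
  proof (cases "side A B C > 0")
    case True
    then have D': "side B C A > 0" "side C A B > 0" by (simp_all add: side_rotate)
    show ?thesis using triangle_angle_sum[OF True] angle_at_cis(2,3)[OF D'(1)] angle_at_cis(2,3)[OF D'(2)] by (simp add: ang)
  next
    case False
    then have pos: "side A C B > 0" using tile_positive(1)[OF assms] by (simp add: t)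
    then have D': "side C B A > 0" "side B A C > 0" by (simp_all add: side_rotate)
    show ?thesis using triangle_angle_sum[OF pos] angle_at_cis(2,3)[OF D'(1)] angle_at_cis(2,3)[OF D'(2)] by (simp add: ang)
  qed
  then show "\<alpha> + \<beta> + \<gamma> = pi" "0 < \<beta>" "\<beta> < pi" "0 < \<gamma>" "\<gamma> < pi" by blast+
qed

lemma angle_at_scale:
  assumes "B - A = of_real l * e" "C - A = of_real m * f" "l > 0" "m > 0" "e \<noteq> 0" "f \<noteq> 0"
  shows "angle_at A B C = arccos (e \<bullet> f / (norm e * norm f))"
  unfolding angle_at_def assms(1,2) using assms(3-) by (simp add: norm_mult scaleR_conv_of_real[symmetric])

text \<open>Two planar cones, each contained in the other, are bounded by the same two rays; so the angle of the
  triangle \<open>ABC\<close> at \<open>A\<close> is the angle between \<open>e\<close> and \<open>f\<close>.\<close>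

lemma cone_angle:
  assumes e: "cross e f > 0"
    and b: "cross e (B - A) \<ge> 0" "cross (B - A) f \<ge> 0"
    and c: "cross e (C - A) \<ge> 0" "cross (C - A) f \<ge> 0"
    and ne: "B \<noteq> A" "C \<noteq> A" and \<eta>: "\<eta> > 0"
    and p: "of_real \<eta> * e = of_real p * (B - A) + of_real q * (C - A)" "p \<ge> 0" "q \<ge> 0"
    and r: "of_real \<eta> * f = of_real r * (B - A) + of_real s * (C - A)" "r \<ge> 0" "s \<ge> 0"
  shows "angle_at A B C = arccos (e \<bullet> f / (norm e * norm f))"
proof -
  have e0: "e \<noteq> 0" "f \<noteq> 0" using e by (auto simp: cross_altdef)
  have "0 = cross e (of_real \<eta> * e)" by (simp add: cross_scale_right)
  also have "\<dots> = p * cross e (B - A) + q * cross e (C - A)" unfolding p(1) by (simp add: cross_add_right cross_scale_right)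
  finally have pq: "p * cross e (B - A) = 0" "q * cross e (C - A) = 0"
    using p(2,3) b c by (smt (verit) mult_nonneg_nonneg)+
  have "0 = cross (of_real \<eta> * f) f" by (simp add: cross_scale_left)
  also have "\<dots> = r * cross (B - A) f + s * cross (C - A) f" unfolding r(1) by (simp add: cross_add_left cross_scale_left)
  finally have rs: "r * cross (B - A) f = 0" "s * cross (C - A) f = 0"
    using r(2,3) b c by (smt (verit) mult_nonneg_nonneg)+
  have on_e: "\<exists>l>0. x = of_real l * e" if x: "cross e x = 0" "cross x f \<ge> 0" "x \<noteq> 0" for x
  proof -
    obtain l where l: "x = of_real l * e" using cross_eq_0_imp[OF x(1) e0(1)] by blast
    then have "l \<ge> 0" using x(2) e by (simp add: cross_scale_left zero_le_mult_iff)
    moreover have "l \<noteq> 0" using l x(3) by auto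
    ultimately show ?thesis using l by (intro exI[of _ l]) auto
  qed
  have on_f: "\<exists>l>0. x = of_real l * f" if x: "cross x f = 0" "cross e x \<ge> 0" "x \<noteq> 0" for x
  proof -
    have "cross f x = 0" using x(1) cross_minus_swap[of f x] by simp
    then obtain l where l: "x = of_real l * f" using cross_eq_0_imp[OF _ e0(2)] by blast
    then have "l \<ge> 0" using x(2) e by (simp add: cross_scale_right zero_le_mult_iff)
    moreover have "l \<noteq> 0" using l x(3) by auto
    ultimately show ?thesis using l by (intro exI[of _ l]) auto
  qed
  have nz: "p \<noteq> 0 \<or> q \<noteq> 0" "r \<noteq> 0 \<or> s \<noteq> 0" using p(1) r(1) \<eta> e0 by auto
  have not_both: "\<not> (cross e x = 0 \<and> cross x f = 0)" if "x \<noteq> 0" for x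
  proof
    assume a: "cross e x = 0 \<and> cross x f = 0"
    then obtain l where l: "x = of_real l * e" using cross_eq_0_imp[OF _ e0(1)] by blast
    then have "l = 0" using a e by (simp add: cross_scale_left)
    then show False using l that by simp
  qed
  have BC: "B - A \<noteq> 0" "C - A \<noteq> 0" using ne by auto
  show ?thesis
  proof (cases "cross e (B - A) = 0")
    case True
    then have "r = 0" using rs(1) not_both[OF BC(1)] by auto
    then have "cross (C - A) f = 0" using rs nz by auto
    then obtain m where m: "m > 0" "C - A = of_real m * f" using on_f c BC by blast
    obtain l where l: "l > 0" "B - A = of_real l * e" using on_e True b BC by blast
    show ?thesis by (rule angle_at_scale[OF l(2) m(2) l(1) m(1) e0])
  next
    case False
    then have "q \<noteq> 0" using pq nz by auto
    then have c0: "cross e (C - A) = 0" using pq by auto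
    then have "s = 0" using rs(2) not_both[OF BC(2)] by auto
    then have "cross (B - A) f = 0" using rs nz by auto
    then obtain m where m: "m > 0" "B - A = of_real m * f" using on_f b BC by blast
    obtain l where l: "l > 0" "C - A = of_real l * e" using on_e c0 c BC by blast
    have "angle_at A C B = arccos (e \<bullet> f / (norm e * norm f))"
      by (rule angle_at_scale[OF l(2) m(2) l(1) m(1) e0])
    then show ?thesis by (simp add: angle_at_sym)
  qed
qed

lemma region_closed: "closed (region t)"
  by (cases t) (simp add: compact_imp_closed finite_imp_compact_convex_hull)

lemma region_vertices: "region (A, B, C) \<subseteq> P \<Longrightarrow> A \<in> P \<and> B \<in> P \<and> C \<in> P"
  using hull_subset[of "{A, B, C}" convex] by auto

lemma inner_consecutive_edges:
  "(w * (cis (2 * \<delta>) - cis \<delta>)) \<bullet> (w * (1 - cis \<delta>)) = - cos \<delta> * ((norm w)\<^sup>2 * (norm (1 - cis \<delta>))\<^sup>2)"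
proof -
  define x y where "x = cos \<delta>" and "y = sin \<delta>"
  have y: "y * y = 1 - x * x" using sin_cos_squared_add[of \<delta>] by (simp add: x_def y_def power2_eq_square)
  have c2: "cos (2 * \<delta>) = 2 * x * x - 1" "sin (2 * \<delta>) = 2 * y * x"
    by (simp_all add: x_def y_def cos_double_cos sin_double power2_eq_square)
  have sq: "(norm (1 - cis \<delta>))\<^sup>2 = 2 - 2 * x"
  proof -
    have "(norm (1 - cis \<delta>))\<^sup>2 = (1 - x) * (1 - x) + y * y" unfolding cmod_power2 by (simp add: x_def y_def power2_eq_square)
    then show ?thesis unfolding y by (simp add: algebra_simps)
  qed
  have "(w * (cis (2 * \<delta>) - cis \<delta>)) \<bullet> (w * (1 - cis \<delta>)) = (norm w)\<^sup>2 * ((cis (2 * \<delta>) - cis \<delta>) \<bullet> (1 - cis \<delta>))"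
    unfolding inner_complex_def cmod_power2 by (simp add: algebra_simps power2_eq_square)
  also have "(cis (2 * \<delta>) - cis \<delta>) \<bullet> (1 - cis \<delta>) = (2 * x * x - 1 - x) * (1 - x) - (2 * x - 1) * (y * y)"
    unfolding inner_complex_def
    by (simp add: c2 flip: x_def y_def) (simp add: algebra_simps)
  also have "\<dots> = - x * (2 - 2 * x)" unfolding y by (simp add: algebra_simps)
  finally show ?thesis by (simp add: sq x_def)
qed

context regular_polygon
begin

text \<open>If a single tile has a vertex at a vertex of the polygon, and carries the label \<open>\<alpha>\<close> there, then near this
  point the polygon coincides with that tile.\<close>

lemma alpha_eq_ngon_angle:
  assumes T: "triangle_tiling \<alpha> \<beta> \<gamma> T ngon"
    and counts: "angle_counts T (V 1) = (1, 0, 0)"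
  shows "\<alpha> = pi - 2 * pi / N"
proof -
  define v e f where "v = V 1" and "e = V 2 - V 1" and "f = V N - V 1"
  have fin: "finite T" and ang: "\<And>t. t \<in> T \<Longrightarrow> triangle_with_angles \<alpha> \<beta> \<gamma> t"
    and P: "(\<Union>t\<in>T. region t) = ngon"
    using T by (auto simp: triangle_tiling_def)
  have "card {(A, B, C) \<in> T. A = v} = 1" "card {(A, B, C) \<in> T. B = v} = 0" "card {(A, B, C) \<in> T. C = v} = 0"
    using counts by (simp_all add: angle_counts_def v_def)
  moreover have "finite {(A, B, C) \<in> T. B = v}" "finite {(A, B, C) \<in> T. C = v}"
    using fin by (auto intro: finite_subset[of _ T])
  ultimately have c1: "\<exists>t. {(A, B, C) \<in> T. A = v} = {t}" and c2: "{(A, B, C) \<in> T. B = v} = {}" "{(A, B, C) \<in> T. C = v} = {}"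
    by (simp_all add: card_1_singleton_iff)
  obtain t0 where t0: "{(A, B, C) \<in> T. A = v} = {t0}" using c1 by blast
  have "t0 \<in> {(A, B, C) \<in> T. A = v}" unfolding t0 by simp
  then obtain B C where t0e: "t0 = (v, B, C)" "(v, B, C) \<in> T" by auto
  have only: "(A', B', C') = t0" if "(A', B', C') \<in> T" "v \<in> {A', B', C'}" for A' B' C'
    using that t0 c2 by blast
  have VN1: "V (N + 1) = V 1" using vertex_periodic[of 1] by simp
  have in_cone: "cross e (x - v) \<ge> 0" "cross (x - v) f \<ge> 0" if "x \<in> ngon" for x
  proof -
    show "cross e (x - v) \<ge> 0" using half_plane[of 1 x] that N by (simp add: side_def e_def v_def numeral_2_eq_2)
    have "side (V N) (V 1) x \<ge> 0" using half_plane[of N x] that N VN1 by simp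
    then show "cross (x - v) f \<ge> 0" by (simp add: side_def f_def v_def cross_altdef algebra_simps)
  qed
  have V0: "V N = V 0" using vertex_periodic[of 0] by simp
  have ef: "cross e f > 0"
  proof -
    have "cross e f = side (V 1) (V 2) (V N)" by (simp add: side_def e_def f_def)
    also have "\<dots> = (cmod w)\<^sup>2 * (2 * sin (pi / N) * (cos (pi / N) - cos (3 * pi / N)))"
      unfolding V0 using side_edge[of 1 0] by (simp add: numeral_2_eq_2)
    also have "\<dots> > 0"
    proof -
      have "sin (pi / N) > 0" using N_pos by (intro sin_gt_zero) (auto simp: field_simps)
      moreover have "cos (3 * pi / N) < cos (pi / N)" using N by (intro cos_monotone_0_pi) (auto simp: field_simps)
      ultimately show ?thesis using w by simp
    qed
    finally show ?thesis .
  qed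
  have v_only: "x = v" if x: "cross e (x - v) = 0" "cross (x - v) f = 0" for x
  proof -
    have "e \<noteq> 0" using ef by (auto simp: cross_altdef)
    then obtain l where l: "x - v = of_real l * e" using cross_eq_0_imp[OF x(1)] by blast
    then have "l = 0" using x(2) ef by (simp add: cross_scale_left)
    then show ?thesis using l by simp
  qed
  have away: "v \<notin> region t" if t: "t \<in> T" "t \<noteq> t0" for t
  proof
    assume "v \<in> region t"
    obtain A' B' C' where te: "t = (A', B', C')" by (cases t)
    have sub: "A' \<in> ngon" "B' \<in> ngon" "C' \<in> ngon" using region_vertices[of A' B' C' ngon] t P te by blast+
    \<comment> \<open>An affine function that is nonnegative on the polygon and vanishes at \<open>v\<close> only.\<close>
    define g where "g x = cross e (x - v) + cross (x - v) f" for x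
    have g0: "g x \<ge> 0" if "x \<in> ngon" for x using in_cone[OF that] by (simp add: g_def)
    have g1: "g x > 0" if "x \<in> ngon" "x \<noteq> v" for x
      using in_cone[OF that(1)] v_only[of x] that(2) by (auto simp: g_def order_less_le)
    obtain a b c where abc: "0 \<le> a" "0 \<le> b" "0 \<le> c" "a + b + c = 1" "v = of_real a * A' + of_real b * B' + of_real c * C'"
      using \<open>v \<in> region t\<close> unfolding te region.simps convex_hull_triangle by blast
    have "g v = a * g A' + b * g B' + c * g C'"
    proof -
      have a: "a = 1 - b - c" using abc by simp
      have "\<And>v. g (of_real a * A' + of_real b * B' + of_real c * C') = a * g A' + b * g B' + c * g C'"
        unfolding a by (simp add: g_def cross_altdef algebra_simps)
      then show ?thesis using abc by simp
    qed
    moreover have "g v = 0" by (simp add: g_def cross_altdef)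
    moreover have "v \<notin> {A', B', C'}" using only t te by blast
    then have "g A' > 0" "g B' > 0" "g C' > 0" using g1 sub by auto
    moreover have "a * g A' + b * g B' + c * g C' > 0"
    proof -
      have "a * g A' \<ge> 0" "b * g B' \<ge> 0" "c * g C' \<ge> 0" using \<open>g A' > 0\<close> \<open>g B' > 0\<close> \<open>g C' > 0\<close> abc by simp_all
      moreover have "a > 0 \<or> b > 0 \<or> c > 0" using abc by linarith
      then have "a * g A' > 0 \<or> b * g B' > 0 \<or> c * g C' > 0" using \<open>g A' > 0\<close> \<open>g B' > 0\<close> \<open>g C' > 0\<close> by auto
      ultimately show ?thesis by linarith
    qed
    ultimately show False by simp
  qed
  \<comment> \<open>Near \<open>v\<close> the tile \<open>t0\<close> alone covers the polygon, in particular the initial pieces of both edges at \<open>v\<close>.\<close>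
  define U where "U = - (\<Union>t\<in>T - {t0}. region t)"
  have "open U" unfolding U_def using fin by (auto intro!: closed_Union region_closed simp: open_Compl)
  have "v \<in> U" using away by (auto simp: U_def)
  have ev: "eventually (\<lambda>\<eta>. v + of_real \<eta> * h \<in> U) (at_right 0)" for h
  proof -
    have "((\<lambda>\<eta>. v + of_real \<eta> * h) \<longlongrightarrow> v + of_real 0 * h) (at_right 0)" by (intro tendsto_intros)
    then show ?thesis using topological_tendstoD[OF _ \<open>open U\<close>] \<open>v \<in> U\<close> by simp
  qed
  have "eventually (\<lambda>\<eta>::real. \<eta> > 0 \<and> \<eta> < 1) (at_right 0)"
    using eventually_at_right_less[of "0::real"] eventually_at_rightI[of 0 1 "\<lambda>x. x < (1::real)"] by (simp add: eventually_conj_iff)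
  then have "eventually (\<lambda>\<eta>. \<eta> > 0 \<and> \<eta> < 1 \<and> v + of_real \<eta> * e \<in> U \<and> v + of_real \<eta> * f \<in> U) (at_right 0)"
    using ev[of e] ev[of f] by (simp add: eventually_conj_iff)
  then obtain \<eta> where \<eta>: "\<eta> > 0" "\<eta> < 1" "v + of_real \<eta> * e \<in> U" "v + of_real \<eta> * f \<in> U"
    using eventually_happens[of _ "at_right (0::real)"] by (metis (mono_tags, lifting) trivial_limit_at_right_real)
  have cx: "convex ngon" by (simp add: regular_ngon_def convex_convex_hull)
  have seg: "v + of_real \<eta> * (x - v) \<in> ngon" if "x \<in> ngon" for x
  proof -
    have "(1 - \<eta>) *\<^sub>R v + \<eta> *\<^sub>R x \<in> ngon"
      using convexD[OF cx, of v x "1 - \<eta>" \<eta>] that vertex_in[of 1] N \<eta> by (simp add: v_def)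
    moreover have "(1 - \<eta>) *\<^sub>R v + \<eta> *\<^sub>R x = v + of_real \<eta> * (x - v)"
      by (simp add: scaleR_conv_of_real algebra_simps)
    ultimately show ?thesis by simp
  qed
  have inside: "\<exists>p q. of_real \<eta> * (x - v) = of_real p * (B - v) + of_real q * (C - v) \<and> p \<ge> 0 \<and> q \<ge> 0"
    if "x \<in> ngon" "v + of_real \<eta> * (x - v) \<in> U" for x
  proof -
    have "v + of_real \<eta> * (x - v) \<in> region t0" using seg[OF that(1)] that(2) P by (auto simp: U_def)
    then obtain a p q where apq: "0 \<le> p" "0 \<le> q" "a + p + q = 1" "v + of_real \<eta> * (x - v) = of_real a * v + of_real p * B + of_real q * C"
      unfolding t0e region.simps convex_hull_triangle by blast
    have a: "a = 1 - p - q" using apq by simp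
    have "of_real \<eta> * (x - v) = of_real a * v + of_real p * B + of_real q * C - v" using apq(4) by (simp add: algebra_simps)
    also have "\<dots> = of_real p * (B - v) + of_real q * (C - v)" unfolding a by (simp add: algebra_simps)
    finally show ?thesis using apq by blast
  qed
  have V2: "V 2 \<in> ngon" "V N \<in> ngon" using vertex_in N by auto
  obtain p q where pq: "of_real \<eta> * e = of_real p * (B - v) + of_real q * (C - v)" "p \<ge> 0" "q \<ge> 0"
    using inside[OF V2(1)] \<eta>(3) by (auto simp: e_def v_def)
  obtain r s where rs: "of_real \<eta> * f = of_real r * (B - v) + of_real s * (C - v)" "r \<ge> 0" "s \<ge> 0"
    using inside[OF V2(2)] \<eta>(4) by (auto simp: f_def v_def)
  have BC: "B \<in> ngon" "C \<in> ngon" using region_vertices[of v B C ngon] t0e P by blast+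
  have t0a: "\<not> collinear {v, B, C}" "angle_at v B C = \<alpha>" using ang[OF t0e(2)] by simp_all
  have "\<alpha> = arccos (e \<bullet> f / (norm e * norm f))"
    unfolding t0a(2)[symmetric]
    by (rule cone_angle[OF ef in_cone[OF BC(1)] in_cone[OF BC(2)] _ _ \<eta>(1) pq rs]) (use t0a(1) in \<open>auto simp: insert_commute\<close>)
  also have "e \<bullet> f / (norm e * norm f) = - cos (2 * pi / N)"
  proof -
    define \<delta> where "\<delta> = 2 * pi / N"
    have e: "e = w * (cis (2 * \<delta>) - cis \<delta>)" by (simp add: e_def ngon_vertex_def \<delta>_def algebra_simps)
    have f: "f = w * (1 - cis \<delta>)" unfolding f_def V0 by (simp add: ngon_vertex_def \<delta>_def algebra_simps)
    have "cis (2 * \<delta>) = cis \<delta> * cis \<delta>" by (simp only: mult_2 cis_mult)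
    then have e': "cis (2 * \<delta>) - cis \<delta> = cis \<delta> * (cis \<delta> - 1)" by (simp add: right_diff_distrib)
    have ne: "norm e = norm w * norm (1 - cis \<delta>)" "norm f = norm w * norm (1 - cis \<delta>)"
      unfolding e f e' norm_mult by (simp_all add: norm_minus_commute)
    have "e \<bullet> f = - cos \<delta> * ((norm w)\<^sup>2 * (norm (1 - cis \<delta>))\<^sup>2)"
      unfolding e f by (rule inner_consecutive_edges)
    moreover have "e \<noteq> 0" using ef by (auto simp: cross_altdef)
    then have "norm (1 - cis \<delta>) \<noteq> 0" "norm w \<noteq> 0" using ne by auto
    ultimately show ?thesis unfolding ne \<delta>_def[symmetric] by (simp add: power2_eq_square)
  qed
  also have "- cos (2 * pi / N) = cos (pi - 2 * pi / N)" by simp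
  also have "arccos (cos (pi - 2 * pi / N)) = pi - 2 * pi / N" using N_pos by (intro arccos_cos) auto
  finally show ?thesis .
qed

end

section \<open>Conjugate areas\<close>

text \<open>Twice the signed area of the triangle \<open>0, X, Y\<close> of the shape given by the angles \<open>a\<close> and \<open>b\<close>, multiplied by
  \<open>sin b\<close>. Here \<open>a\<close> and \<open>b\<close> are arbitrary real numbers, as they are multiples of angles in the application.\<close>

lemma cross_similar:
  assumes "Y * (cis (2 * b) - 1) = X * (cis (- (2 * a)) - 1)"
  shows "cross X Y * sin b = (norm X)\<^sup>2 * sin (a + b) * sin a"
proof -
  define q :: complex where "q = 2 * \<i>"
  have q0: "q \<noteq> 0" by (simp add: q_def)
  have c: "cis (2 * t) - 1 = q * of_real (sin t) * cis t" for t
  proof -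
    have "sin t * sin t = 1 - cos t * cos t" using sin_cos_squared_add[of t] by (simp add: power2_eq_square)
    then show ?thesis by (simp add: q_def complex_eq_iff cos_double_cos sin_double power2_eq_square)
  qed
  have "cis (- (2 * a)) - 1 = - (q * of_real (sin a) * cis (- a))" using c[of "- a"] by simp
  then have "Y * (q * of_real (sin b) * cis b) = X * - (q * of_real (sin a) * cis (- a))"
    using assms c[of b] by (simp only:)
  then have "q * (of_real (sin b) * Y * cis b) = q * (- of_real (sin a) * (X * cis (- a)))"
    by (simp add: mult_ac)
  then have "of_real (sin b) * Y * cis b = - of_real (sin a) * (X * cis (- a))" using mult_left_cancel[OF q0] by blast
  then have "of_real (sin b) * Y * cis b * cis (- b) = - of_real (sin a) * (X * (cis (- a) * cis (- b)))" by simp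
  then have "of_real (sin b) * Y = of_real (- sin a) * (X * cis (- (a + b)))" by (simp add: cis_mult mult.assoc)
  then have "sin b * cross X Y = - sin a * cross X (X * cis (- (a + b)))"
    by (metis cross_scale_right)
  also have "cross X (X * cis (- (a + b))) = (norm X)\<^sup>2 * sin (- (a + b))"
    using cross_cis[of X 0 "- (a + b)"] by simp
  finally show ?thesis by (simp only: sin_minus) (simp add: mult_ac)
qed

lemma sin_rational_nonzero:
  fixes k m L :: nat
  assumes "L > 0" "coprime k L" "\<not> L dvd m"
  shows "sin (k * (pi * m / L)) \<noteq> 0"
proof
  assume "sin (k * (pi * m / L)) = 0"
  then obtain i :: int where "k * (pi * m / L) = i * pi" by (auto simp: sin_zero_iff_int2)
  then have "real (k * m) = real_of_int (i * int L)" using assms(1) by (simp add: field_simps)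
  then have "int (k * m) = i * int L" by (metis of_int_eq_iff of_int_of_nat_eq)
  then have "int L dvd int (k * m)" by simp
  then have "L dvd k * m" by (simp only: of_nat_dvd_iff)
  then show False using assms by (metis coprime_commute coprime_dvd_mult_right_iff)
qed

context regular_polygon
begin

text \<open>The conjugate area argument. A semilinear map \<open>\<Psi>\<close> sends the vertices of the polygon to those of a star
  polygon of nonzero size, two consecutive ones being seen from the centre under the angle \<open>2 k \<pi> / N\<close>. The
  counterclockwise vertices of a tile go to those of a triangle, possibly degenerate, whose signed area is a
  nonnegative multiple of the conjugate of \<open>sin \<alpha> sin \<beta> / sin \<gamma>\<close>. Its sign is that of
  \<open>sin (2 k \<pi> / N) sin (k \<beta>) sin (k \<gamma>)\<close> for every tile, so it must be the sign of the area of the star polygon,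
  which is that of \<open>sin (2 k \<pi> / N)\<close>.\<close>

lemma conjugate_sines_positive:
  fixes b g M L k :: nat and \<alpha> \<beta> \<gamma> :: real
  assumes T: "triangle_tiling \<alpha> \<beta> \<gamma> T ngon"
    and L: "L = N * M" "L > 0" and bg: "b + g = 2 * M" "0 < b" "b < L" "0 < g" "g < L"
    and \<beta>: "\<beta> = pi * b / L" and \<gamma>: "\<gamma> = pi * g / L"
    and k: "coprime k L"
  shows "sin (k * \<beta>) * sin (k * \<gamma>) > 0"
proof (rule ccontr)
  assume neg: "\<not> sin (k * \<beta>) * sin (k * \<gamma>) > 0"
  define \<zeta> where "\<zeta> = cis (2 * pi / L)"
  have Lr: "real L > 0" using L by simp
  have \<zeta>pow: "\<zeta> ^ i = cis (2 * pi * i / L)" for i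
    unfolding \<zeta>_def Complex.DeMoivre by (simp add: mult.commute)
  have \<zeta>L: "\<zeta> ^ L = 1" using Lr by (simp add: \<zeta>pow)
  have \<zeta>cnj: "cnj (\<zeta> ^ i) = \<zeta> ^ ((L - 1) * i)" for i
  proof -
    have "\<zeta> ^ ((L - 1) * i) * \<zeta> ^ i = \<zeta> ^ (L * i)"
      using L(2) by (simp add: power_add[symmetric] diff_mult_distrib)
    also have "\<dots> = 1" by (simp add: power_mult \<zeta>L)
    also have "1 = cnj (\<zeta> ^ i) * \<zeta> ^ i" by (simp add: \<zeta>pow cis_cnj cis_mult)
    finally show ?thesis by (simp add: \<zeta>pow)
  qed
  have \<zeta>ne: "\<zeta> ^ i \<noteq> \<zeta> ^ j" if "i < j" "j - i < L" for i j
  proof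
    assume "\<zeta> ^ i = \<zeta> ^ j"
    also have "\<zeta> ^ j = \<zeta> ^ i * \<zeta> ^ (j - i)" using that by (simp add: power_add[symmetric])
    finally have "\<zeta> ^ (j - i) = 1" by (simp add: \<zeta>pow)
    then have "cos (2 * pi * real (j - i) / L) = 1" by (simp add: \<zeta>pow complex_eq_iff)
    then obtain n :: int where "2 * pi * real (j - i) / L = of_int n * 2 * pi" unfolding cos_one_2pi_int by blast
    then have "real (j - i) = real_of_int (n * int L)" using Lr by (simp add: field_simps)
    then have "int (j - i) = n * int L" by (metis of_int_eq_iff of_int_of_nat_eq)
    then have "int L dvd int (j - i)" by simp
    then have "L dvd j - i" by (simp only: of_nat_dvd_iff)
    then show False using that by (auto dest: dvd_imp_le)
  qed

  obtain \<Phi> :: "complex \<Rightarrow> complex" where \<Phi>: "\<And>x y. \<Phi> (x + y) = \<Phi> x + \<Phi> y" "\<And>z. \<Phi> (\<zeta> * z) = \<zeta> ^ k * \<Phi> z"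
    "\<And>z. \<Phi> (cnj z) = cnj (\<Phi> z)" "\<Phi> 1 \<noteq> 0"
    using ex_semilinear[OF L(2) \<zeta>L k] by blast
  define \<Psi> where "\<Psi> z = \<Phi> (z / w)" for z
  have add: "\<Psi> (x + y) = \<Psi> x + \<Psi> y" for x y by (simp add: \<Psi>_def add_divide_distrib \<Phi>)
  have zero: "\<Psi> 0 = 0" using add[of 0 0] by simp
  have minus: "\<Psi> (- x) = - \<Psi> x" for x using add[of x "- x"] zero by (simp add: add_eq_0_iff)
  have diff: "\<Psi> (x - y) = \<Psi> x - \<Psi> y" for x y using add[of x "- y"] minus by simp
  have semi: "\<Psi> (\<zeta> ^ i * z) = \<zeta> ^ (k * i) * \<Psi> z" for i z
  proof (induction i)
    case (Suc i)
    have "\<Psi> (\<zeta> ^ Suc i * z) = \<zeta> ^ k * \<Psi> (\<zeta> ^ i * z)" using \<Phi>(2)[of "\<zeta> ^ i * z / w"] by (simp add: \<Psi>_def mult.assoc)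
    then show ?case using Suc by (simp add: power_add mult.assoc)
  qed simp
  have semi_diff: "\<Psi> (z * (\<zeta> ^ i - \<zeta> ^ j)) = \<Psi> z * (\<zeta> ^ (k * i) - \<zeta> ^ (k * j))" for z i j
    using semi[of i z] semi[of j z] by (simp add: right_diff_distrib diff mult.commute)

  \<comment> \<open>The directions whose real lines are mapped into real lines. They are stable under the cyclotomic
    integers that occur, so that a tile has all of its sides in \<open>K\<close> or none of them.\<close>
  define K where "K u \<longleftrightarrow> (\<exists>v. \<forall>r. \<exists>s. \<Psi> (of_real r * u) = of_real s * v)" for u
  have K_mult: "K (u * (\<zeta> ^ i - \<zeta> ^ j))" if u: "K u" for u i j
  proof -
    obtain v where v: "\<And>r. \<exists>s. \<Psi> (of_real r * u) = of_real s * v" using u unfolding K_def by blast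
    have "\<exists>s. \<Psi> (of_real r * (u * (\<zeta> ^ i - \<zeta> ^ j))) = of_real s * (v * (\<zeta> ^ (k * i) - \<zeta> ^ (k * j)))" for r
      using v[of r] semi_diff[of "of_real r * u" i j] by (metis mult.assoc)
    then show ?thesis unfolding K_def by blast
  qed
  have K_scale: "K (of_real t * u)" if u: "K u" for t u
  proof -
    obtain v where v: "\<And>r. \<exists>s. \<Psi> (of_real r * u) = of_real s * v" using u unfolding K_def by blast
    have "\<exists>s. \<Psi> (of_real r * (of_real t * u)) = of_real s * v" for r
      using v[of "r * t"] by (simp add: mult.assoc)
    then show ?thesis unfolding K_def by blast
  qed
  have K_scale_iff: "K (of_real t * u) \<longleftrightarrow> K u" if "t \<noteq> 0" for t u
  proof -
    have "of_real (inverse t) * (of_real t * u) = u" using that by (simp add: mult.assoc[symmetric])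
    then show ?thesis using K_scale[of u t] K_scale[of "of_real t * u" "inverse t"] by metis
  qed
  have K_minus: "K (- u) \<longleftrightarrow> K u" for u using K_scale_iff[of "-1" u] by simp
  have K_mult_iff: "K (u * (\<zeta> ^ i - \<zeta> ^ j)) \<longleftrightarrow> K u" if ne: "\<zeta> ^ i \<noteq> \<zeta> ^ j" for u i j
  proof
    assume "K (u * (\<zeta> ^ i - \<zeta> ^ j))"
    then have "K (u * (\<zeta> ^ i - \<zeta> ^ j) * (\<zeta> ^ ((L - 1) * i) - \<zeta> ^ ((L - 1) * j)))" by (rule K_mult)
    also have "u * (\<zeta> ^ i - \<zeta> ^ j) * (\<zeta> ^ ((L - 1) * i) - \<zeta> ^ ((L - 1) * j)) = of_real ((norm (\<zeta> ^ i - \<zeta> ^ j))\<^sup>2) * u"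
      unfolding complex_norm_square complex_cnj_diff \<zeta>cnj by (simp add: mult_ac)
    finally have "K (of_real ((norm (\<zeta> ^ i - \<zeta> ^ j))\<^sup>2) * u)" .
    moreover have "(norm (\<zeta> ^ i - \<zeta> ^ j))\<^sup>2 \<noteq> 0" using ne by simp
    ultimately show "K u" using K_scale_iff by blast
  qed (rule K_mult)
  have K_w: "K w"
  proof -
    have "\<Psi> (of_real r * w) = of_real (Re (\<Phi> (of_real r))) * 1" for r
    proof -
      have "cnj (\<Phi> (of_real r)) = \<Phi> (of_real r)" using \<Phi>(3)[of "of_real r"] by simp
      then have "\<Phi> (of_real r) = of_real (Re (\<Phi> (of_real r)))" by (simp add: complex_eq_iff)
      then show ?thesis using w by (simp add: \<Psi>_def)
    qed
    then show ?thesis unfolding K_def by blast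
  qed

  \<comment> \<open>Twice the signed area swept from the origin by the image of a segment. Segments with directions outside
    \<open>K\<close> are ignored, as \<open>\<Psi>\<close> need not respect collinearity there.\<close>
  define E where "E P Q = (if K (Q - P) then cross (\<Psi> P) (\<Psi> Q) else 0)" for P Q
  have E_add: "E (z + of_real r * d) (z + of_real s * d) = E z (z + of_real s * d) - E z (z + of_real r * d)" for z d r s
  proof (cases "K d")
    case True
    then obtain v where v: "\<And>r. \<exists>s. \<Psi> (of_real r * d) = of_real s * v" unfolding K_def by blast
    obtain r' s' where rs: "\<Psi> (of_real r * d) = of_real r' * v" "\<Psi> (of_real s * d) = of_real s' * v" using v by metis
    have "K (z + of_real s * d - (z + of_real r * d))"
      using K_scale[OF True, of "s - r"] by (simp add: algebra_simps)
    moreover have "K (z + of_real t * d - z)" for t using K_scale[OF True] by simp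
    ultimately show ?thesis
      unfolding E_def add rs by (simp add: cross_add_left cross_add_right cross_scale_left cross_scale_right cross_minus_swap[of v "\<Psi> z"])
  next
    case False
    have "E (z + of_real r * d) (z + of_real s * d) = 0" for r s
    proof (cases "r = s")
      case False
      have "z + of_real s * d - (z + of_real r * d) = of_real (s - r) * d" by (simp add: algebra_simps)
      then show ?thesis using False \<open>\<not> K d\<close> K_scale_iff[of "s - r" d] by (simp add: E_def)
    qed (simp add: E_def)
    from this[of r s] this[of 0 r] this[of 0 s] show ?thesis by simp
  qed
  have E_triangle: "E P Q + E Q R + E R P = cross (\<Psi> (Q - P)) (\<Psi> (R - P))" if "K (Q - P)" "K (R - Q)" "K (R - P)" for P Q R
    using that K_minus[of "R - P"] by (simp add: E_def diff cross_diff_left cross_diff_right cross_minus_swap[of "\<Psi> R" "\<Psi> P"] cross_minus_swap[of "\<Psi> Q" "\<Psi> P"])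

  define S where "S = sin (k * (2 * pi / N))"
  have Nr: "real N > 0" using N by simp
  have kN: "coprime k N" using k L by auto
  have S0: "S \<noteq> 0"
  proof -
    have "\<not> N dvd 2" using N by (auto dest: dvd_imp_le)
    then have "sin (k * (pi * real 2 / N)) \<noteq> 0" using sin_rational_nonzero[of N k 2] kN N by blast
    then show ?thesis unfolding S_def by (simp only: mult.commute[of pi] of_nat_numeral not_False_eq_True)
  qed
  have sum: "\<beta> + \<gamma> = 2 * pi / N"
  proof -
    have "\<beta> + \<gamma> = pi * real (b + g) / L" by (simp add: \<beta> \<gamma> add_divide_distrib distrib_left)
    then show ?thesis using L Nr by (simp add: bg field_simps)
  qed

  have tile: "(E (first_vertex t) (second_vertex t) + E (second_vertex t) (third_vertex t) + E (third_vertex t) (first_vertex t)) * S \<le> 0"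
    if t: "t \<in> T" for t
  proof -
    have ang: "triangle_with_angles \<alpha> \<beta> \<gamma> t" using T t by (auto simp: triangle_tiling_def)
    define A B C where "A = first_vertex t" and "B = second_vertex t" and "C = third_vertex t"
    obtain \<mu> \<nu> :: real where \<mu>\<nu>: "(\<mu>, \<nu>) \<in> {(\<beta>, \<gamma>), (\<gamma>, \<beta>)}"
      and sim: "(C - A) * (cis (2 * \<nu>) - 1) = (B - A) * (cis (- (2 * \<mu>)) - 1)"
      using tile_similarity[OF ang] unfolding A_def B_def C_def by blast
    obtain m n :: nat where mn: "\<mu> = pi * m / L" "\<nu> = pi * n / L" "0 < m" "m < L" "0 < n" "n < L" "m + n = 2 * M"
      using \<mu>\<nu> bg \<beta> \<gamma> by (metis (no_types, lifting) Pair_inject add.commute insert_iff singletonD)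
    have c: "cis (2 * \<nu>) = \<zeta> ^ n" "cis (- (2 * \<mu>)) * \<zeta> ^ m = 1"
      by (simp_all add: \<zeta>pow mn cis_mult mult.assoc)
    \<comment> \<open>Multiplication by \<open>\<zeta>\<^sup>m\<close> clears the negative exponent.\<close>
    have r1: "(C - A) * (\<zeta> ^ (n + m) - \<zeta> ^ m) = (B - A) * (\<zeta> ^ 0 - \<zeta> ^ m)"
    proof -
      have "(C - A) * (\<zeta> ^ n - 1) * \<zeta> ^ m = (B - A) * (cis (- (2 * \<mu>)) * \<zeta> ^ m - \<zeta> ^ m)"
        using sim unfolding c(1) by (simp only: left_diff_distrib mult.assoc mult_1_left)
      then show ?thesis unfolding c(2) by (simp add: power_add algebra_simps)
    qed
    have "(C - B) * (\<zeta> ^ (n + m) - \<zeta> ^ m) = (C - A) * (\<zeta> ^ (n + m) - \<zeta> ^ m) - (B - A) * (\<zeta> ^ (n + m) - \<zeta> ^ m)"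
      by (simp add: algebra_simps)
    then have r2: "(C - B) * (\<zeta> ^ (n + m) - \<zeta> ^ m) = (B - A) * (\<zeta> ^ 0 - \<zeta> ^ (n + m))"
      unfolding r1 by (simp add: algebra_simps)
    have "2 * M < N * M" using N L by simp
    then have nmL: "n + m < L" using mn L by linarith
    have ne: "\<zeta> ^ (n + m) \<noteq> \<zeta> ^ m" "\<zeta> ^ 0 \<noteq> \<zeta> ^ m" "\<zeta> ^ 0 \<noteq> \<zeta> ^ (n + m)"
      using \<zeta>ne[of m "n + m"] \<zeta>ne[of 0 m] \<zeta>ne[of 0 "n + m"] mn nmL by auto
    have KCA: "K (C - A) \<longleftrightarrow> K (B - A)"
      using K_mult_iff[OF ne(1), of "C - A"] K_mult_iff[OF ne(2), of "B - A"] r1 by simp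
    have KCB: "K (C - B) \<longleftrightarrow> K (B - A)"
      using K_mult_iff[OF ne(1), of "C - B"] K_mult_iff[OF ne(3), of "B - A"] r2 by simp
    show ?thesis
    proof (cases "K (B - A)")
      case True
      define X Y where "X = \<Psi> (B - A)" and "Y = \<Psi> (C - A)"
      have tr: "E A B + E B C + E C A = cross X Y"
        unfolding X_def Y_def by (rule E_triangle) (use True KCA KCB in auto)
      have "\<Psi> ((C - A) * (\<zeta> ^ (n + m) - \<zeta> ^ m)) = \<Psi> ((B - A) * (\<zeta> ^ 0 - \<zeta> ^ m))" using r1 by simp
      then have "Y * (\<zeta> ^ (k * (n + m)) - \<zeta> ^ (k * m)) = X * (1 - \<zeta> ^ (k * m))"
        unfolding semi_diff X_def Y_def by simp
      moreover have ck: "\<zeta> ^ (k * n) = cis (2 * (k * \<nu>))" "\<zeta> ^ (k * m) * cis (- (2 * (k * \<mu>))) = 1"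
        by (simp_all add: \<zeta>pow mn cis_mult) (simp add: mult_ac)+
      ultimately have "Y * (cis (2 * (k * \<nu>)) - 1) * \<zeta> ^ (k * m) = X * (cis (- (2 * (k * \<mu>))) - 1) * \<zeta> ^ (k * m)"
        by (simp add: distrib_left power_add algebra_simps)
      then have "Y * (cis (2 * (k * \<nu>)) - 1) = X * (cis (- (2 * (k * \<mu>))) - 1)" by (simp add: \<zeta>pow)
      then have cs: "cross X Y * sin (k * \<nu>) = (norm X)\<^sup>2 * sin (k * \<mu> + k * \<nu>) * sin (k * \<mu>)"
        by (rule cross_similar)
      have "\<mu> + \<nu> = 2 * pi / N" using \<mu>\<nu> sum by auto
      then have "k * \<mu> + k * \<nu> = k * (2 * pi / N)" by (metis distrib_left)
      then have S: "sin (k * \<mu> + k * \<nu>) = S" by (simp add: S_def)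
      have s\<nu>: "sin (k * \<nu>) \<noteq> 0" unfolding mn
        by (rule sin_rational_nonzero) (use L k mn in \<open>auto dest: dvd_imp_le\<close>)
      have prod: "sin (k * \<mu>) * sin (k * \<nu>) \<le> 0" using neg \<mu>\<nu> by (auto simp: mult.commute)
      have "cross X Y * S * (sin (k * \<nu>))\<^sup>2 = ((norm X)\<^sup>2 * S\<^sup>2) * (sin (k * \<mu>) * sin (k * \<nu>))"
      proof -
        have "cross X Y * S * (sin (k * \<nu>))\<^sup>2 = (cross X Y * sin (k * \<nu>)) * S * sin (k * \<nu>)" by (simp add: power2_eq_square)
        then show ?thesis unfolding cs S by (simp add: power2_eq_square mult_ac)
      qed
      also have "\<dots> \<le> 0" by (rule mult_nonneg_nonpos[OF _ prod]) simp
      finally have "cross X Y * S \<le> 0"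
        using s\<nu> mult_pos_pos[of "cross X Y * S" "(sin (k * \<nu>))\<^sup>2"] by (fastforce simp: not_le[symmetric])
      then show ?thesis unfolding A_def[symmetric] B_def[symmetric] C_def[symmetric] tr .
    next
      case False
      then have "\<not> K (A - C)" using KCA K_minus[of "C - A"] by simp
      then have "E A B + E B C + E C A = 0" using False KCB by (simp add: E_def)
      then show ?thesis unfolding A_def B_def C_def by simp
    qed
  qed

  have poly: "E c (V j) + E (V j) (V (j + 1)) + E (V (j + 1)) c = (norm (\<Psi> w))\<^sup>2 * S" for j
  proof -
    have power_angle: "2 * pi * real (M * i) / L = 2 * pi * i / N" for i
      using L Nr by (simp add: field_simps)
    have Vc: "V i - c = \<zeta> ^ (M * i) * w" for i
      unfolding vertex_diff \<zeta>pow power_angle by (simp add: mult.commute)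
    have \<Psi>V: "\<Psi> (V i - c) = \<Psi> w * cis (i * (k * (2 * pi / N)))" for i
    proof -
      have "2 * pi * real (k * (M * i)) / L = k * (2 * pi * real (M * i) / L)" by simp
      also have "\<dots> = i * (k * (2 * pi / N))" unfolding power_angle by simp
      finally have "\<zeta> ^ (k * (M * i)) = cis (i * (k * (2 * pi / N)))" unfolding \<zeta>pow by (rule arg_cong)
      then show ?thesis unfolding Vc semi by (simp only: mult.commute)
    qed
    have K1: "K (V i - c)" for i
    proof -
      have "\<exists>s. \<Psi> (of_real r * (V i - c)) = of_real s * (\<zeta> ^ (k * (M * i)) * v)"
        if "\<exists>s. \<Psi> (of_real r * w) = of_real s * v" for r v
        using that semi[of "M * i" "of_real r * w"] by (metis Vc mult.left_commute)
      then show ?thesis using K_w unfolding K_def by blast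
    qed
    have "V (j + 1) - V j = w * (\<zeta> ^ (M * (j + 1)) - \<zeta> ^ (M * j))"
      using Vc[of j] Vc[of "j + 1"] by (simp add: algebra_simps)
    then have K2: "K (V (j + 1) - V j)" using K_mult[OF K_w] by simp
    have "E c (V j) + E (V j) (V (j + 1)) + E (V (j + 1)) c = cross (\<Psi> (V j - c)) (\<Psi> (V (j + 1) - c))"
      by (rule E_triangle[OF K1 K2 K1])
    also have "\<dots> = (norm (\<Psi> w))\<^sup>2 * sin (real (j + 1) * (k * (2 * pi / N)) - j * (k * (2 * pi / N)))"
      unfolding \<Psi>V cross_cis ..
    also have "real (j + 1) * (k * (2 * pi / N)) - j * (k * (2 * pi / N)) = k * (2 * pi / N)"
      unfolding of_nat_add of_nat_1 distrib_right by simp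
    finally show ?thesis by (simp add: S_def)
  qed

  have "(\<Sum>t\<in>T. E (first_vertex t) (second_vertex t) + E (second_vertex t) (third_vertex t) + E (third_vertex t) (first_vertex t))
      = (\<Sum>j\<in>{1..N}. E c (V j) + E (V j) (V (j + 1)) + E (V (j + 1)) c)"
    by (rule tiling_valuation[OF T]) (rule E_add)
  also have "\<dots> = N * ((norm (\<Psi> w))\<^sup>2 * S)" unfolding poly by simp
  finally have "(\<Sum>t\<in>T. E (first_vertex t) (second_vertex t) + E (second_vertex t) (third_vertex t) + E (third_vertex t) (first_vertex t)) * S
      = N * (norm (\<Psi> w))\<^sup>2 * S\<^sup>2" by (simp add: power2_eq_square)
  moreover have "(\<Sum>t\<in>T. E (first_vertex t) (second_vertex t) + E (second_vertex t) (third_vertex t) + E (third_vertex t) (first_vertex t)) * S \<le> 0"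
    unfolding sum_distrib_right by (rule sum_nonpos) (rule tile)
  moreover have "\<Psi> w \<noteq> 0" using \<Phi>(4) w by (simp add: \<Psi>_def)
  then have "N * (norm (\<Psi> w))\<^sup>2 * S\<^sup>2 > 0" using S0 Nr by simp
  ultimately show False by simp
qed

end

section \<open>Conjugate cosine inequalities\<close>

lemma sum_cis_progression_eq_0:
  fixes s :: int and l :: nat
  assumes "l > 0" "\<not> int l dvd s"
  shows "(\<Sum>t<l. cos (x + 2 * pi * s * real t / l)) = 0"
proof -
  let ?z = "cis (2 * pi * s / l)"
  have z1: "?z \<noteq> 1"
  proof
    assume "?z = 1"
    then have "cos (2 * pi * s / l) = 1" by (simp add: complex_eq_iff)
    then obtain n :: int where "2 * pi * s / l = of_int n * 2 * pi" unfolding cos_one_2pi_int by blast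
    then have "real_of_int s = real_of_int (n * int l)" using assms(1) by (simp add: field_simps)
    then have "s = n * int l" by (simp only: of_int_eq_iff)
    then show False using assms(2) by simp
  qed
  have "l * (2 * pi * s / l) = 2 * pi * s" using assms(1) by simp
  then have "?z ^ l = cis (2 * pi * s)" by (simp only: Complex.DeMoivre)
  also have "\<dots> = 1" by (simp add: complex_eq_iff cos_int_2pin sin_int_2pin)
  finally have "(\<Sum>t<l. ?z ^ t) = 0" using z1 by (simp add: geometric_sum)
  then have "(\<Sum>t<l. cis x * ?z ^ t) = 0" by (simp add: sum_distrib_left[symmetric])
  moreover have "cis x * ?z ^ t = cis (x + 2 * pi * s * real t / l)" for t
    unfolding Complex.DeMoivre cis_mult by (simp add: mult.commute)
  ultimately have "(\<Sum>t<l. cis (x + 2 * pi * s * real t / l)) = 0" by simp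
  then have "Re (\<Sum>t<l. cis (x + 2 * pi * s * real t / l)) = 0" by simp
  then show ?thesis by simp
qed

text \<open>Let \<open>x = 2 \<pi> s / L\<close>; the hypothesis on primes says that \<open>L\<close> is the least multiple of \<open>N\<close> for which \<open>x\<close> is
  an integral multiple of \<open>2 \<pi> / L\<close>. Suppose \<open>\<bar>x\<bar> < 2 \<pi> / N\<close>. If \<open>cos x > cos (2 \<pi> / N)\<close> and
  this inequality persists under all conjugations, then \<open>x = 0\<close>. For a prime \<open>l\<close> dividing \<open>L / N\<close>, consider the
  conjugations by \<open>k \<equiv> 1\<close> modulo \<open>L / l\<close>, which fix \<open>cos (2 \<pi> / N) \<ge> 1/2\<close>. The values \<open>cos (k x)\<close> of all residues
  \<open>k\<close> of this form sum to zero, at most one of the residues is not coprime to \<open>L\<close>, and all others contribute more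
  than \<open>1/2\<close>. This leaves only \<open>l = 2\<close> and \<open>L = 2 N\<close> with \<open>N\<close> odd, where \<open>k = N - 2\<close> gives the contradiction.\<close>

lemma totally_positive_imp_zero:
  fixes N L :: nat and s :: int
  assumes N: "N > 5" and NL: "N dvd L" "L > 0"
    and small: "\<bar>s\<bar> * int N < int L"
    and min: "\<And>l. prime l \<Longrightarrow> l dvd L div N \<Longrightarrow> \<not> int l dvd s"
    and pos: "\<And>k. coprime k L \<Longrightarrow> cos (k * (2 * pi * s / L)) > cos (k * (2 * pi / N))"
  shows "s = 0"
proof (cases "L = N")
  case True
  then have "\<bar>s\<bar> * int N < 1 * int N" using small by simp
  then have "\<bar>s\<bar> < 1" using N by (subst (asm) mult_less_cancel_right_pos) auto
  then show ?thesis by simp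
next
  case False
  define M where "M = L div N"
  have LM: "L = N * M" using NL by (simp add: M_def)
  have M1: "M > 1" using False NL LM by (cases "M = 0"; cases "M = 1") auto
  have c: "cos (2 * pi / N) \<ge> 1 / 2"
  proof -
    have "2 * pi / N \<le> pi / 3" using N by (simp add: field_simps)
    then have "cos (pi / 3) \<le> cos (2 * pi / N)" by (intro cos_monotone_0_pi_le) auto
    then show ?thesis by (simp add: cos_60)
  qed
  have two: "l = 2 \<and> odd (L div 2)" if l: "prime l" "l dvd M" for l
  proof -
    have lpos: "l > 0" using l prime_gt_0_nat by blast
    define Q where "Q = L div l"
    have lL: "l dvd L" using l LM by auto
    have LQ: "L = Q * l" using lL by (simp add: Q_def)
    obtain M' where M': "M = l * M'" using l by blast
    have QN: "Q = N * M'" using LM LQ M' lpos by (simp add: mult_ac)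
    define k where "k t = 1 + Q * t" for t
    \<comment> \<open>The prime \<open>l\<close> is the only possible common divisor of \<open>k t\<close> and \<open>L\<close>, so \<open>G\<close> collects the residues
      coprime to \<open>L\<close>.\<close>
    define G where "G = {t. t < l \<and> \<not> l dvd k t}"
    define D where "D = {t. t < l \<and> l dvd k t}"
    have fin: "finite G" "finite D" by (auto simp: G_def D_def)
    have cop: "coprime (k t) L" if t: "t \<in> G" for t
    proof (rule ccontr)
      assume "\<not> coprime (k t) L"
      then obtain p where p: "prime p" "p dvd k t" "p dvd L"
        by (metis coprime_iff_gcd_eq_1 gcd_greatest_iff prime_factor_nat)
      have "p \<noteq> l" using p(2) t by (auto simp: G_def)
      then have "p dvd Q" using p l LQ by (metis prime_dvd_mult_iff primes_dvd_imp_eq)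
      then have "p dvd 1" using p(2) unfolding k_def by (metis dvd_add_left_iff dvd_mult2)
      then show False using p(1) by simp
    qed
    have kx: "k t * (2 * pi * s / L) = 2 * pi * s / L + 2 * pi * s * real t / l" for t
    proof -
      have "real Q / real L = 1 / l" using LQ NL lpos by simp
      moreover have "real Q * (2 * pi * s / L) = real Q / real L * (2 * pi * s)" by simp
      ultimately have "real Q * (2 * pi * s / L) = 2 * pi * s / l" by simp
      have "k t * (2 * pi * s / L) = 2 * pi * s / L + real t * (real Q * (2 * pi * s / L))"
        unfolding k_def of_nat_add of_nat_mult of_nat_1 distrib_right by simp
      also have "\<dots> = 2 * pi * s / L + 2 * pi * s * real t / l"
        unfolding \<open>real Q * (2 * pi * s / L) = 2 * pi * s / l\<close> by simp
      finally show ?thesis .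
    qed
    have ky: "cos (k t * (2 * pi / N)) = cos (2 * pi / N)" for t
    proof -
      have e: "k t * (2 * pi / N) = 2 * pi / N + 2 * pi * of_int (int (M' * t))"
        using N by (simp add: k_def QN field_simps)
      show ?thesis unfolding e cos_add cos_int_2pin sin_int_2pin by simp
    qed
    have big: "cos (2 * pi * s / L + 2 * pi * s * real t / l) > 1 / 2" if "t \<in> G" for t
      using pos[OF cop[OF that]] c unfolding kx ky by linarith
    have GD: "{..<l} = G \<union> D" "G \<inter> D = {}" by (auto simp: G_def D_def)
    then have split: "(\<Sum>t<l. f t) = sum f G + sum f D" for f :: "nat \<Rightarrow> real"
      using fin by (simp add: sum.union_disjoint)
    have card: "l = card G + card D"
      using card_Un_disjoint[OF fin GD(2)] card_lessThan[of l] unfolding GD(1) by simp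
    have zero: "(\<Sum>t\<in>G. cos (2 * pi * s / L + 2 * pi * s * real t / l)) + (\<Sum>t\<in>D. cos (2 * pi * s / L + 2 * pi * s * real t / l)) = 0"
      using sum_cis_progression_eq_0[of l s "2 * pi * s / L"] min[of l] l lpos unfolding split M_def by auto
    have Dbound: "(\<Sum>t\<in>D. cos (2 * pi * s / L + 2 * pi * s * real t / l)) \<ge> - real (card D)"
      using sum_bounded_below[of D "-1" "\<lambda>t. cos (2 * pi * s / L + 2 * pi * s * real t / l)"] by simp
    have D1: "card D \<le> 1 \<and> (D \<noteq> {} \<longrightarrow> \<not> l dvd Q)"
    proof (cases "l dvd Q")
      case True
      have "\<not> l dvd k t" for t
      proof
        assume "l dvd k t"
        then have "l dvd 1" using True unfolding k_def by (metis dvd_add_left_iff dvd_mult2)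
        then show False using l by simp
      qed
      then have "D = {}" by (auto simp: D_def)
      then show ?thesis by simp
    next
      case False
      have "t = t'" if t: "t \<in> D" "t' \<in> D" "t \<le> t'" for t t'
      proof -
        have "l dvd k t' - k t" using t by (simp add: D_def dvd_diff_nat)
        moreover have "k t' - k t = Q * (t' - t)" by (simp add: k_def diff_mult_distrib2)
        ultimately have "l dvd t' - t" using False l prime_dvd_mult_nat by auto
        moreover have "t' - t < l" using t by (auto simp: D_def)
        ultimately show ?thesis using t by (metis dvd_imp_le le_antisym leD not_gr_zero diff_is_0_eq)
      qed
      then have "\<forall>t\<in>D. \<forall>t'\<in>D. t = t'" by (metis nat_le_linear)
      then have "card D \<le> 1" using card_le_Suc0_iff_eq[OF fin(2)] by simp
      then show ?thesis using False by simp
    qed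
    have "l \<ge> 2" using l prime_ge_2_nat by blast
    then have "G \<noteq> {}" using card D1 by auto
    then have "(\<Sum>t\<in>G. 1 / 2) < (\<Sum>t\<in>G. cos (2 * pi * s / L + 2 * pi * s * real t / l))"
      using fin big by (intro sum_strict_mono) auto
    then have "real (card G) / 2 < card D" using zero Dbound by simp
    then have "card G < 2 * card D" by linarith
    then have "card D = 1" "card G < 2" using D1 by linarith+
    then have l2: "l = 2" using card \<open>l \<ge> 2\<close> by linarith
    have "D \<noteq> {}" using \<open>card D = 1\<close> by auto
    then show ?thesis using D1 l2 by (simp add: Q_def)
  qed
  obtain p where p: "prime p" "p dvd M" using M1 prime_factor_nat by (metis less_irrefl)
  then have "2 dvd M" "odd (L div 2)" using two by auto
  then obtain M' where M': "M = 2 * M'" by blast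
  have L2: "L div 2 = N * M'" using LM M' by simp
  have "M' = 1"
  proof (rule ccontr)
    assume "M' \<noteq> 1"
    then obtain p where p: "prime p" "p dvd M'" using prime_factor_nat by blast
    then have "p = 2" using two[of p] M' by simp
    then show False using p \<open>odd (L div 2)\<close> L2 by auto
  qed
  then have L: "L = 2 * N" and Nodd: "odd N" using LM M' L2 \<open>odd (L div 2)\<close> by simp_all
  have "\<not> 2 dvd s" using min[of 2] \<open>2 dvd M\<close> by (simp add: M_def)
  moreover have "\<bar>s\<bar> * int N < 2 * int N" using small L by simp
  then have "\<bar>s\<bar> < 2" using N by (subst (asm) mult_less_cancel_right_pos) auto
  ultimately have s: "s = 1 \<or> s = -1" by presburger
  have Nr: "real N > 0" using N by simp
  \<comment> \<open>The multiplier \<open>N - 2\<close> brings \<open>x = \<plusminus> \<pi> / N\<close> close to \<open>\<pi>\<close>.\<close>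
  have "coprime (N - 2) L"
  proof (rule ccontr)
    assume "\<not> coprime (N - 2) L"
    then obtain p where p: "prime p" "p dvd N - 2" "p dvd L"
      by (metis coprime_iff_gcd_eq_1 gcd_greatest_iff prime_factor_nat)
    have "odd (N - 2)" using Nodd N by simp
    then have "p \<noteq> 2" using p by auto
    then have "p dvd N" using p L by (metis prime_dvd_mult_iff primes_dvd_imp_eq two_is_prime_nat)
    then have "p dvd N - (N - 2)" using p(2) by (rule dvd_diff_nat)
    then have "p dvd 2" using N by simp
    then show False using \<open>p \<noteq> 2\<close> p(1) primes_dvd_imp_eq two_is_prime_nat by blast
  qed
  from pos[OF this] have "cos (real (N - 2) * (2 * pi * s / L)) > cos (real (N - 2) * (2 * pi / N))" .
  moreover have "cos (real (N - 2) * (2 * pi * s / L)) = - cos (2 * pi / N)"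
  proof -
    have "real (N - 2) * (2 * pi * s / L) = of_int s * (pi - 2 * pi / N)"
      using N Nr by (simp add: L of_nat_diff field_simps)
    then show ?thesis using s by auto
  qed
  moreover have "cos (real (N - 2) * (2 * pi / N)) = 2 * (cos (2 * pi / N))\<^sup>2 - 1"
  proof -
    have e: "real (N - 2) * (2 * pi / N) = 2 * pi - 2 * (2 * pi / N)"
      using N Nr by (simp add: of_nat_diff field_simps)
    show ?thesis unfolding e cos_2pi_minus cos_double_cos ..
  qed
  ultimately have "(2 * cos (2 * pi / N) - 1) * (cos (2 * pi / N) + 1) < 0"
    by (simp add: algebra_simps power2_eq_square)
  moreover have "(2 * cos (2 * pi / N) - 1) * (cos (2 * pi / N) + 1) \<ge> 0"
    using c by (intro mult_nonneg_nonneg) auto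
  ultimately show ?thesis by linarith
qed

section \<open>Tilings of the regular polygon\<close>

theorem theorem4:
  fixes N :: nat and \<alpha> \<beta> \<gamma> :: real and c w :: complex and T :: "tile set"
  assumes "N > 5"
    and "w \<noteq> 0"
    and "\<alpha> / pi \<in> \<rat>" and "\<beta> / pi \<in> \<rat>" and "\<gamma> / pi \<in> \<rat>"
    and "triangle_tiling \<alpha> \<beta> \<gamma> T (regular_ngon c w N)"
    and "\<And>j. j \<in> {1..N} \<Longrightarrow> angle_counts T (ngon_vertex c w N j) = (1, 0, 0)"
  shows "\<beta> = pi / real N \<and> \<gamma> = pi / real N"
proof -
  interpret regular_polygon N c w by unfold_locales (use assms in auto)
  have Nr: "real N > 0" using assms(1) by simp
  have "\<alpha> = pi - 2 * pi / N" by (rule alpha_eq_ngon_angle[OF assms(6)]) (use assms in auto)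
  obtain t where t: "triangle_with_angles \<alpha> \<beta> \<gamma> t"
    using assms(6) center_in unfolding triangle_tiling_def by blast
  note ang = tile_angles[OF t]
  have sum: "\<beta> + \<gamma> = 2 * pi / N" using ang(1) \<open>\<alpha> = _\<close> by linarith
  define x where "x = (\<beta> - \<gamma>) / (2 * pi)"
  have "x \<in> \<rat>"
  proof -
    have e: "x = (\<beta> / pi - \<gamma> / pi) / 2" by (simp add: x_def diff_divide_distrib)
    show ?thesis unfolding e using assms(4,5) by (intro Rats_divide[OF Rats_diff]) simp_all
  qed
  then obtain p q :: int where pq: "q > 0" "x = of_int p / of_int q" by (rule Rats_cases')
  \<comment> \<open>The minimal admissible modulus, as required by \<open>totally_positive_imp_zero\<close>.\<close>
  define good where "good L \<longleftrightarrow> L > 0 \<and> N dvd L \<and> real L * x \<in> \<int>" for L :: nat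
  have "good (N * nat q)"
    using pq assms(1) by (auto simp: good_def)
  define L where "L = (LEAST L. good L)"
  have L: "good L" unfolding L_def by (rule LeastI) fact
  obtain s :: int where s: "real L * x = of_int s" using L by (auto simp: good_def elim: Ints_cases)
  obtain M where LM: "L = N * M" using L by (auto simp: good_def)
  have Lpos: "L > 0" "real L > 0" "M > 0" using L LM by (auto simp: good_def)
  have diff: "\<beta> - \<gamma> = 2 * pi * s / L"
    using s Lpos by (simp add: x_def field_simps)
  have sumL: "\<beta> + \<gamma> = 2 * pi * M / L" using sum Nr Lpos by (simp add: LM field_simps)
  have \<beta>: "\<beta> = pi * (int M + s) / L" and \<gamma>: "\<gamma> = pi * (int M - s) / L"
    using diff sumL Lpos by (simp_all add: field_simps)
  have range: "0 < int M + s" "int M + s < int L" "0 < int M - s" "int M - s < int L"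
  proof -
    have "0 < pi * real_of_int (int M + s)" "pi * real_of_int (int M + s) < pi * L"
      "0 < pi * real_of_int (int M - s)" "pi * real_of_int (int M - s) < pi * L"
      using ang(2-5) Lpos unfolding \<beta> \<gamma> by (simp_all add: field_simps)
    then have "0 < real_of_int (int M + s)" "real_of_int (int M + s) < L"
      "0 < real_of_int (int M - s)" "real_of_int (int M - s) < L"
      by (simp_all only: zero_less_mult_iff mult_less_cancel_left_pos pi_gt_zero) auto
    then show "0 < int M + s" "int M + s < int L" "0 < int M - s" "int M - s < int L" by linarith+
  qed
  define b g where "b = nat (int M + s)" and "g = nat (int M - s)"
  have bg: "b + g = 2 * M" "0 < b" "b < L" "0 < g" "g < L" using range by (simp_all add: b_def g_def)
  have \<beta>b: "\<beta> = pi * b / L" and \<gamma>g: "\<gamma> = pi * g / L" using range \<beta> \<gamma> by (simp_all add: b_def g_def)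
  have "s = 0"
  proof (rule totally_positive_imp_zero[OF assms(1)])
    show "N dvd L" "L > 0" using L by (auto simp: good_def)
    have "\<bar>s\<bar> < int M" using range by linarith
    then have "\<bar>s\<bar> * int N < int M * int N" using assms(1) by (intro mult_strict_right_mono) auto
    then show "\<bar>s\<bar> * int N < int L" by (simp add: LM mult.commute)
  next
    fix l assume l: "prime l" "l dvd L div N"
    show "\<not> int l dvd s"
    proof
      assume "int l dvd s"
      then obtain s' where s': "s = int l * s'" by blast
      have "l dvd M" using l LM assms(1) by simp
      then obtain M' where M': "M = l * M'" by blast
      have l1: "l > 1" using l prime_gt_1_nat by blast
      have "real (N * M') * x = of_int s'"
        using s l1 by (simp add: LM M' s')
      then have "good (N * M')" using Lpos M' LM by (auto simp: good_def)
      then have "L \<le> N * M'" unfolding L_def by (rule Least_le)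
      then show False using Lpos LM M' l1 by auto
    qed
  next
    fix k assume k: "coprime k L"
    have "0 < sin (k * \<beta>) * sin (k * \<gamma>)"
      by (rule conjugate_sines_positive[OF assms(6) LM Lpos(1) bg \<beta>b \<gamma>g k])
    also have "\<dots> = (cos (k * \<beta> - k * \<gamma>) - cos (k * \<beta> + k * \<gamma>)) / 2" by (rule sin_times_sin)
    also have "k * \<beta> - k * \<gamma> = k * (2 * pi * s / L)" using diff by (metis right_diff_distrib)
    also have "k * \<beta> + k * \<gamma> = k * (2 * pi / N)" using sum by (metis distrib_left)
    finally show "cos (k * (2 * pi * s / L)) > cos (k * (2 * pi / N))" by simp
  qed
  then show ?thesis using sum diff by simp
qed

end
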